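(* Let $W_\xi:=\mathrm{shift}(\xi_0,\xi_1,\ldots)$ be a subnormal contractive unilateral weighted shift with Berger measure $\nu$, let $\gamma_n:=\int s^n\,d\nu(s)$ ($n\ge0$) be its moments (so $\gamma_0=1$ and $\gamma_n=\xi_0^2\cdots\xi_{n-1}^2$ for $n\ge 1$), and let $0<y\le1$. Let $\mathbf{T}\equiv(T_1,T_2)$ be the (bounded) $2$-variable weighted shift on $\ell^2(\mathbb{Z}_+^2)$ with weights $$\alpha_{(k_1,0)}=\xi_{k_1},\quad\alpha_{(k_1,k_2)}=1\ (k_2\ge1),\qquad\beta_{(k_1,0)}=\frac{y}{\sqrt{\gamma_{k_1}}},\quad\beta_{(k_1,k_2)}=1\ (k_2\ge1),$$ for all $k_1\ge0$. If $\mathbf{T}$ is hyponormal, then $\mathbf{T}$ is subnormal.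
   Context: A pair $\mathbf{T}=(T_1,T_2)$ of bounded operators on a Hilbert space $\mathcal H$ is (jointly) hyponormal if the operator matrix $\begin{pmatrix}[T_1^*,T_1]&[T_2^*,T_1]\\ [T_1^*,T_2]&[T_2^*,T_2]\end{pmatrix}$ is positive on $\mathcal H\oplus\mathcal H$, where $[S,T]=ST-TS$. It is normal if $T_1,T_2$ commute and each is normal, and subnormal if it is the restriction of a normal pair to a common invariant subspace. $\mathrm{shift}(\xi_0,\xi_1,\ldots)$ is the unilateral weighted shift $e_n\mapsto\xi_ne_{n+1}$ on $\ell^2(\mathbb{Z}_+)$ with positive bounded weights. It is subnormal iff there is a probability measure $\nu$ on $[0,\|W_\xi\|^2]$ (its Berger measure) with $\xi_0^2\cdots\xi_{k-1}^2=\int s^k\,d\nu(s)$ for all $k\ge1$. The $2$-variable weighted shift with positive weights $\alpha_{\mathbf k},\beta_{\mathbf k}$ ($\mathbf k\in\mathbb{Z}_+^2$) is the pair on $\ell^2(\mathbb{Z}_+^2)$ given by $T_1e_{\mathbf k}=\alpha_{\mathbf k}e_{\mathbf k+(1,0)}$, $T_2e_{\mathbf k}=\beta_{\mathbf k}e_{\mathbf k+(0,1)}$; weight families are always assumed bounded (so $T_1,T_2$ are bounded operators). *)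

theory Defs
  imports "HOL-Probability.Probability" "HOL-Library.Function_Algebras"
begin

section \<open>Complex Hilbert spaces\<close>

text \<open>
  A complex inner product space is given by a carrier inside an ambient complex vector space
  (whose addition is that of the type) together with an inner product, linear in its first
  argument.
\<close>

record 'a hspace =
  hcarrier :: "'a set"
  hscale :: "complex \<Rightarrow> 'a \<Rightarrow> 'a"
  hinner :: "'a \<Rightarrow> 'a \<Rightarrow> complex"

definition hnorm :: "'a hspace \<Rightarrow> 'a \<Rightarrow> real" where
  "hnorm H x = sqrt (Re (hinner H x x))"

locale hilbert_space = vector_space "hscale H" for H :: "('a::ab_group_add) hspace" +
  assumes subspace_carrier: "subspace (hcarrier H)"
    and inner_add: "\<lbrakk>x \<in> hcarrier H; y \<in> hcarrier H; z \<in> hcarrier H\<rbrakk>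
      \<Longrightarrow> hinner H (x + y) z = hinner H x z + hinner H y z"
    and inner_scale: "\<lbrakk>x \<in> hcarrier H; y \<in> hcarrier H\<rbrakk>
      \<Longrightarrow> hinner H (hscale H c x) y = c * hinner H x y"
    and inner_cnj: "\<lbrakk>x \<in> hcarrier H; y \<in> hcarrier H\<rbrakk> \<Longrightarrow> hinner H y x = cnj (hinner H x y)"
    and inner_nonneg: "x \<in> hcarrier H \<Longrightarrow> hinner H x x \<in> \<real>\<^sub>\<ge>\<^sub>0"
    and inner_eq_0: "\<lbrakk>x \<in> hcarrier H; hinner H x x = 0\<rbrakk> \<Longrightarrow> x = 0"
    and complete: "Metric_space.mcomplete (hcarrier H) (\<lambda>x y. hnorm H (x - y))"

definition hsum :: "'a hspace \<Rightarrow> 'b hspace \<Rightarrow> ('a \<times> 'b) hspace" where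
  "hsum H K = \<lparr> hcarrier = hcarrier H \<times> hcarrier K,
                hscale = (\<lambda>c (x, y). (hscale H c x, hscale K c y)),
                hinner = (\<lambda>(x, y) (x', y'). hinner H x x' + hinner K y y') \<rparr>"

definition ell2 :: "('i \<Rightarrow> complex) hspace" where
  "ell2 = \<lparr> hcarrier = {f. (\<lambda>i. (cmod (f i))\<^sup>2) summable_on UNIV},
            hscale = (\<lambda>c f i. c * f i),
            hinner = (\<lambda>f g. \<Sum>\<^sub>\<infinity>i. f i * cnj (g i)) \<rparr>"

definition ket :: "'i \<Rightarrow> 'i \<Rightarrow> complex" where
  "ket i = (\<lambda>j. if j = i then 1 else 0)"


section \<open>Bounded operators\<close>

definition linear_map ::
    "('a::ab_group_add) hspace \<Rightarrow> ('b::ab_group_add) hspace \<Rightarrow> ('a \<Rightarrow> 'b) \<Rightarrow> bool" where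
  "linear_map H K T \<longleftrightarrow> T \<in> hcarrier H \<rightarrow> hcarrier K
     \<and> (\<forall>x\<in>hcarrier H. \<forall>y\<in>hcarrier H. T (x + y) = T x + T y)
     \<and> (\<forall>c. \<forall>x\<in>hcarrier H. T (hscale H c x) = hscale K c (T x))"

definition bounded_op :: "('a::ab_group_add) hspace \<Rightarrow> ('a \<Rightarrow> 'a) \<Rightarrow> bool" where
  "bounded_op H T \<longleftrightarrow> linear_map H H T
     \<and> (\<exists>B. \<forall>x\<in>hcarrier H. hnorm H (T x) \<le> B * hnorm H x)"

definition opnorm :: "'a hspace \<Rightarrow> ('a \<Rightarrow> 'a) \<Rightarrow> real" where
  "opnorm H T = (SUP x\<in>{x \<in> hcarrier H. hnorm H x \<le> 1}. hnorm H (T x))"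

definition adj :: "'a hspace \<Rightarrow> ('a \<Rightarrow> 'a) \<Rightarrow> 'a \<Rightarrow> 'a" where
  "adj H T y = (THE z. z \<in> hcarrier H \<and> (\<forall>x\<in>hcarrier H. hinner H (T x) y = hinner H x z))"

definition commutator :: "('a \<Rightarrow> 'a) \<Rightarrow> ('a \<Rightarrow> 'a) \<Rightarrow> 'a \<Rightarrow> ('a::ab_group_add)" where
  "commutator S T x = S (T x) - T (S x)"

definition positive_op :: "'a hspace \<Rightarrow> ('a \<Rightarrow> 'a) \<Rightarrow> bool" where
  "positive_op H A \<longleftrightarrow> (\<forall>x\<in>hcarrier H. hinner H (A x) x \<in> \<real>\<^sub>\<ge>\<^sub>0)"

definition op_matrix ::
    "('a \<Rightarrow> 'a) \<Rightarrow> ('a \<Rightarrow> 'a) \<Rightarrow> ('a \<Rightarrow> 'a) \<Rightarrow> ('a \<Rightarrow> 'a) \<Rightarrow> 'a \<times> 'a \<Rightarrow> ('a::ab_group_add) \<times> 'a" where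
  "op_matrix A B C D = (\<lambda>(x, y). (A x + B y, C x + D y))"


section \<open>Hyponormality, normality and subnormality\<close>

definition hyponormal_pair :: "('a::ab_group_add) hspace \<Rightarrow> ('a \<Rightarrow> 'a) \<Rightarrow> ('a \<Rightarrow> 'a) \<Rightarrow> bool" where
  "hyponormal_pair H T1 T2 \<longleftrightarrow> bounded_op H T1 \<and> bounded_op H T2
     \<and> positive_op (hsum H H)
         (op_matrix (commutator (adj H T1) T1) (commutator (adj H T2) T1)
                    (commutator (adj H T1) T2) (commutator (adj H T2) T2))"

definition normal_op :: "('a::ab_group_add) hspace \<Rightarrow> ('a \<Rightarrow> 'a) \<Rightarrow> bool" where
  "normal_op H T \<longleftrightarrow> bounded_op H T \<and> (\<forall>x\<in>hcarrier H. commutator (adj H T) T x = 0)"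

definition normal_pair :: "('a::ab_group_add) hspace \<Rightarrow> ('a \<Rightarrow> 'a) \<Rightarrow> ('a \<Rightarrow> 'a) \<Rightarrow> bool" where
  "normal_pair H T1 T2 \<longleftrightarrow> normal_op H T1 \<and> normal_op H T2
     \<and> (\<forall>x\<in>hcarrier H. commutator T1 T2 x = 0)"

definition isometric_embedding ::
    "('a::ab_group_add) hspace \<Rightarrow> ('b::ab_group_add) hspace \<Rightarrow> ('a \<Rightarrow> 'b) \<Rightarrow> bool" where
  "isometric_embedding H K V \<longleftrightarrow> linear_map H K V
     \<and> (\<forall>x\<in>hcarrier H. \<forall>y\<in>hcarrier H. hinner K (V x) (V y) = hinner H x y)"

text \<open>
  The Hilbert space \<open>K\<close> of the extension contains \<open>H\<close> through an isometric embedding \<open>V\<close>; the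
  intertwining relations say that the range of \<open>V\<close> is invariant and that the restriction to it is
  the given operator (or pair). Both the vectors and the inner product of \<open>K\<close> are existentially
  quantified. Drawing the vectors of \<open>K\<close> from the same ambient space as those of \<open>H\<close> is no
  restriction: an arbitrary normal extension may be replaced by a minimal one, whose Hilbert space
  is \<open>H\<close> itself if \<open>H\<close> is finite-dimensional, and otherwise has the same Hamel dimension as \<open>H\<close>, so
  that its inner product can be transported to the vector space underlying \<open>H\<close>.
\<close>

definition subnormal_op :: "('a::ab_group_add) hspace \<Rightarrow> ('a \<Rightarrow> 'a) \<Rightarrow> bool" where
  "subnormal_op H T \<longleftrightarrow> bounded_op H T
     \<and> (\<exists>(K :: 'a hspace) V N.
          hilbert_space K \<and> isometric_embedding H K V \<and> normal_op K N
          \<and> (\<forall>x\<in>hcarrier H. N (V x) = V (T x)))"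

definition subnormal_pair :: "('a::ab_group_add) hspace \<Rightarrow> ('a \<Rightarrow> 'a) \<Rightarrow> ('a \<Rightarrow> 'a) \<Rightarrow> bool" where
  "subnormal_pair H T1 T2 \<longleftrightarrow> bounded_op H T1 \<and> bounded_op H T2
     \<and> (\<exists>(K :: 'a hspace) V N1 N2.
          hilbert_space K \<and> isometric_embedding H K V \<and> normal_pair K N1 N2
          \<and> (\<forall>x\<in>hcarrier H. N1 (V x) = V (T1 x) \<and> N2 (V x) = V (T2 x)))"


section \<open>Weighted shifts\<close>

text \<open>
  The shifts are given by their action on coordinates, so that on the canonical basis they act as in
  \<open>wshift_ket\<close>, \<open>shift1_ket\<close> and \<open>shift2_ket\<close> below.
\<close>

definition wshift :: "(nat \<Rightarrow> real) \<Rightarrow> (nat \<Rightarrow> complex) \<Rightarrow> nat \<Rightarrow> complex" where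
  "wshift \<xi> f n = (case n of 0 \<Rightarrow> 0 | Suc m \<Rightarrow> of_real (\<xi> m) * f m)"

definition shift1 :: "(nat \<times> nat \<Rightarrow> real) \<Rightarrow> (nat \<times> nat \<Rightarrow> complex) \<Rightarrow> nat \<times> nat \<Rightarrow> complex" where
  "shift1 \<alpha> f k = (case k of (0, n) \<Rightarrow> 0 | (Suc m, n) \<Rightarrow> of_real (\<alpha> (m, n)) * f (m, n))"

definition shift2 :: "(nat \<times> nat \<Rightarrow> real) \<Rightarrow> (nat \<times> nat \<Rightarrow> complex) \<Rightarrow> nat \<times> nat \<Rightarrow> complex" where
  "shift2 \<beta> f k = (case k of (m, 0) \<Rightarrow> 0 | (m, Suc n) \<Rightarrow> of_real (\<beta> (m, n)) * f (m, n))"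

lemma wshift_ket: "wshift \<xi> (ket n) = hscale ell2 (of_real (\<xi> n)) (ket (Suc n))"
  by (auto simp: wshift_def ket_def ell2_def fun_eq_iff split: nat.splits)

lemma shift1_ket: "shift1 \<alpha> (ket (m, n)) = hscale ell2 (of_real (\<alpha> (m, n))) (ket (m + 1, n))"
  by (auto simp: shift1_def ket_def ell2_def fun_eq_iff split: nat.splits)

lemma shift2_ket: "shift2 \<beta> (ket (m, n)) = hscale ell2 (of_real (\<beta> (m, n))) (ket (m, n + 1))"
  by (auto simp: shift2_def ket_def ell2_def fun_eq_iff split: nat.splits)

definition berger_measure :: "(nat \<Rightarrow> real) \<Rightarrow> real measure \<Rightarrow> bool" where
  "berger_measure \<xi> \<nu> \<longleftrightarrow> prob_space \<nu> \<and> sets \<nu> = sets borel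
     \<and> (AE s in \<nu>. s \<in> {0..(opnorm ell2 (wshift \<xi>))\<^sup>2})
     \<and> (\<forall>k\<ge>1. (\<Prod>i<k. (\<xi> i)\<^sup>2) = (\<integral>s. s ^ k \<partial>\<nu>))"

end

theory Submission
  imports Defs
begin

text \<open>
  The squared norms of \<open>T\<^sub>1\<^sup>m T\<^sub>2\<^sup>n e\<^sub>0\<close> are \<open>\<gamma> m\<close> for \<open>n = 0\<close> and \<open>y\<^sup>2\<close> for \<open>n \<ge> 1\<close>. They are
  the moments of \<open>(\<nu> - y\<^sup>2 \<delta>) \<times> \<delta>' + y\<^sup>2 (\<delta> \<times> \<delta>)\<close>, where \<open>\<delta>\<close> and \<open>\<delta>'\<close> are the unit masses at \<open>1\<close>
  and \<open>0\<close>. Hence the pair is subnormal as soon as this measure is positive, that is, as soon as \<open>\<nu>\<close> has an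
  atom of mass at least \<open>y\<^sup>2\<close> at \<open>1\<close>. Hyponormality gives exactly this: the self-commutator of \<open>T\<^sub>2\<close> is
  positive, so the vertical weights increase from the bottom row to the next
  (\<open>hyponormal_shift2_weights_mono\<close>), which says \<open>y\<^sup>2 \<le> \<gamma> m\<close>; since \<open>\<nu>\<close> lives on \<open>[0, 1]\<close>,
  the moments \<open>\<gamma> m\<close> converge to \<open>\<nu> {1}\<close> (\<open>measure_atom_at_1_ge\<close>).

  The normal extension is written down on a space of square-summable families. With
  \<open>\<rho> = \<nu> - y\<^sup>2 \<delta>\<close>, consider multiplication by \<open>sqrt s\<close> on \<open>L\<^sup>2(\<rho>)\<close>. In the basis of
  orthonormal polynomials in \<open>sqrt s\<close> it is a Jacobi matrix \<open>J\<close>, and the coordinates \<open>c m\<close> of the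
  monomials satisfy \<open>J (c m) = c (m + 1)\<close> and have squared norm \<open>\<gamma> m - y\<^sup>2\<close> (\<open>jacobi_matrix\<close>). Only the
  positive form \<open>\<integral> p q d\<rho>\<close> on polynomials enters, so \<open>L\<^sup>2(\<rho>)\<close> itself is never formed.
  Let \<open>S\<close> be the bilateral shift on \<open>\<ell>\<^sup>2(\<int>)\<close>. The commuting normal operators
    \<open>N\<^sub>1 = S \<otimes> (J \<oplus> 1)\<close> and \<open>N\<^sub>2 = 1 \<otimes> (0 \<oplus> S)\<close>
  on \<open>\<ell>\<^sup>2(\<int>) \<otimes> (\<ell>\<^sup>2(\<nat>) \<oplus> \<ell>\<^sup>2(\<int>))\<close> extend the pair: the two summands carry the two parts of the
  measure, the shifts carry the phases, and the basis vector \<open>(m, 0)\<close> corresponds to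
  \<open>e\<^sub>m \<otimes> (c m \<oplus> y e\<^sub>0) / sqrt (\<gamma> m)\<close>, while \<open>(m, n)\<close> with \<open>n \<ge> 1\<close> corresponds to \<open>e\<^sub>m \<otimes> (0 \<oplus> e\<^sub>n)\<close>
  (\<open>moment_embedding\<close>). Relabelling the countable index set turns this into an extension in the
  space of families on \<open>\<nat> \<times> \<nat>\<close> (\<open>subnormal_pair_ell2I\<close>).
\<close>

section \<open>The Hilbert space of square-summable families\<close>

abbreviation \<L>\<^sub>2 :: "('i \<Rightarrow> complex) set" where
  "\<L>\<^sub>2 \<equiv> hcarrier ell2"

lemma ell2_iff: "f \<in> \<L>\<^sub>2 \<longleftrightarrow> (\<lambda>i. (cmod (f i))\<^sup>2) summable_on UNIV"
  by (simp add: ell2_def)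

lemma hscale_ell2 [simp]: "hscale ell2 c f = (\<lambda>i. c * f i)"
  by (simp add: ell2_def)

lemma hinner_ell2: "hinner ell2 f g = (\<Sum>\<^sub>\<infinity>i. f i * cnj (g i))"
  by (simp add: ell2_def)

lemma hinner_self: "f \<in> \<L>\<^sub>2 \<Longrightarrow> hinner ell2 f f = of_real (\<Sum>\<^sub>\<infinity>i. (cmod (f i))\<^sup>2)"
proof -
  assume "f \<in> \<L>\<^sub>2"
  then have "((\<lambda>i. (cmod (f i))\<^sup>2) has_sum (\<Sum>\<^sub>\<infinity>i. (cmod (f i))\<^sup>2)) UNIV"
    by (simp add: ell2_iff)
  then have "((\<lambda>i. of_real ((cmod (f i))\<^sup>2) :: complex) has_sum of_real (\<Sum>\<^sub>\<infinity>i. (cmod (f i))\<^sup>2)) UNIV"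
    by (rule has_sum_of_real)
  then show ?thesis
    unfolding hinner_ell2 complex_norm_square[symmetric] by (rule infsumI)
qed

lemma hnorm_ell2: "f \<in> \<L>\<^sub>2 \<Longrightarrow> hnorm ell2 f = sqrt (\<Sum>\<^sub>\<infinity>i. (cmod (f i))\<^sup>2)"
  by (simp add: hnorm_def hinner_self)

lemma hnorm_ell2_nonneg: "f \<in> \<L>\<^sub>2 \<Longrightarrow> 0 \<le> hnorm ell2 f"
  by (simp add: hnorm_ell2 infsum_nonneg)

text \<open>
  Membership and norm are determined by the finite sections \<open>L2_set (cmod \<circ> f) F\<close>; estimates
  are transferred from these to the whole family.
\<close>

lemma L2_set_le_hnorm:
  assumes "f \<in> \<L>\<^sub>2" "finite F"
  shows "L2_set (\<lambda>i. cmod (f i)) F \<le> hnorm ell2 f"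
  using assms unfolding L2_set_def
  by (simp add: hnorm_ell2 ell2_iff finite_sum_le_infsum)

lemma ell2_boundedI:
  assumes "\<And>F. finite F \<Longrightarrow> L2_set (\<lambda>i. cmod (f i)) F \<le> C"
  shows "f \<in> \<L>\<^sub>2" "hnorm ell2 f \<le> C"
proof -
  have C: "0 \<le> C"
    using assms[of "{}"] by simp
  have b: "(\<Sum>i\<in>F. (cmod (f i))\<^sup>2) \<le> C\<^sup>2" if "finite F" for F
    using assms[OF that] unfolding L2_set_def by (simp add: real_le_lsqrt real_sqrt_le_iff sqrt_le_D)
  then have s: "(\<lambda>i. (cmod (f i))\<^sup>2) summable_on UNIV"
    by (intro nonneg_bdd_above_summable_on bdd_aboveI2[where M = "C\<^sup>2"]) auto
  then show f: "f \<in> \<L>\<^sub>2"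
    by (simp add: ell2_iff)
  have "(\<Sum>\<^sub>\<infinity>i. (cmod (f i))\<^sup>2) \<le> C\<^sup>2"
    using s b by (intro infsum_le_finite_sums) auto
  then show "hnorm ell2 f \<le> C"
    using C by (simp add: hnorm_ell2[OF f] real_le_lsqrt)
qed

lemma ell2_add:
  assumes "f \<in> \<L>\<^sub>2" "g \<in> \<L>\<^sub>2"
  shows "f + g \<in> \<L>\<^sub>2" "hnorm ell2 (f + g) \<le> hnorm ell2 f + hnorm ell2 g"
proof -
  have "L2_set (\<lambda>i. cmod ((f + g) i)) F \<le> hnorm ell2 f + hnorm ell2 g" if "finite F" for F
  proof -
    have "L2_set (\<lambda>i. cmod ((f + g) i)) F \<le> L2_set (\<lambda>i. cmod (f i) + cmod (g i)) F"
      by (intro L2_set_mono) (auto simp: norm_triangle_ineq)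
    also have "\<dots> \<le> L2_set (\<lambda>i. cmod (f i)) F + L2_set (\<lambda>i. cmod (g i)) F"
      by (rule L2_set_triangle_ineq)
    also have "\<dots> \<le> hnorm ell2 f + hnorm ell2 g"
      using assms that by (intro add_mono L2_set_le_hnorm)
    finally show ?thesis .
  qed
  then show "f + g \<in> \<L>\<^sub>2" "hnorm ell2 (f + g) \<le> hnorm ell2 f + hnorm ell2 g"
    using ell2_boundedI by blast+
qed

lemma ell2_scale:
  assumes "f \<in> \<L>\<^sub>2"
  shows "(\<lambda>i. c * f i) \<in> \<L>\<^sub>2" "hnorm ell2 (\<lambda>i. c * f i) = cmod c * hnorm ell2 f"
proof -
  show s: "(\<lambda>i. c * f i) \<in> \<L>\<^sub>2"
    using assms by (auto simp: ell2_iff norm_mult power_mult_distrib intro: summable_on_cmult_right)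
  show "hnorm ell2 (\<lambda>i. c * f i) = cmod c * hnorm ell2 f"
    by (simp add: hnorm_ell2[OF s] hnorm_ell2[OF assms] norm_mult power_mult_distrib
        infsum_cmult_right' real_sqrt_mult)
qed

lemma ell2_zero: "0 \<in> \<L>\<^sub>2"
  by (simp add: ell2_iff)

lemma ell2_diff: "f \<in> \<L>\<^sub>2 \<Longrightarrow> g \<in> \<L>\<^sub>2 \<Longrightarrow> f - g \<in> \<L>\<^sub>2"
  using ell2_add(1)[of f "\<lambda>i. - 1 * g i"] ell2_scale(1)[of g "- 1"]
  by (simp add: fun_eq_iff plus_fun_def fun_diff_def)

lemma ket_in_ell2: "ket i \<in> \<L>\<^sub>2"
proof -
  have "(\<lambda>j. (cmod (ket i j))\<^sup>2) summable_on {i}"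
    by simp
  then show ?thesis
    unfolding ell2_iff
    by (rule summable_on_cong_neutral[THEN iffD1, rotated -1]) (auto simp: ket_def)
qed

lemma hinner_ket: "hinner ell2 f (ket i) = f i"
proof -
  have "((\<lambda>j. f j * cnj (ket i j)) has_sum (f i)) UNIV"
    using has_sum_finite[of "{i}" "\<lambda>j. f j * cnj (ket i j)"]
    by (subst has_sum_cong_neutral[where T = "{i}" and g = "\<lambda>j. f j * cnj (ket i j)"])
       (auto simp: ket_def)
  then show ?thesis
    unfolding hinner_ell2 by (rule infsumI)
qed

lemma ell2_mult_summable:
  assumes "f \<in> \<L>\<^sub>2" "g \<in> \<L>\<^sub>2"
  shows "(\<lambda>i. f i * cnj (g i)) summable_on UNIV"
proof -
  have "(\<lambda>i. norm (f i * cnj (g i))) summable_on UNIV"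
    using assms
    by (intro Infinite_Sum.abs_summable_product[of f UNIV "\<lambda>i. cnj (g i)"]) (simp_all add: ell2_iff norm_mult power2_eq_square)
  then show ?thesis
    by (rule abs_summable_summable)
qed

lemma hinner_add_left:
  "\<lbrakk>f \<in> \<L>\<^sub>2; g \<in> \<L>\<^sub>2; h \<in> \<L>\<^sub>2\<rbrakk> \<Longrightarrow> hinner ell2 (f + g) h = hinner ell2 f h + hinner ell2 g h"
  by (simp add: hinner_ell2 distrib_right infsum_add ell2_mult_summable)

lemma hinner_cnj: "hinner ell2 g f = cnj (hinner ell2 f g)"
  by (simp add: hinner_ell2 mult.commute flip: infsum_cnj)

lemma hinner_add_right:
  "\<lbrakk>f \<in> \<L>\<^sub>2; g \<in> \<L>\<^sub>2; h \<in> \<L>\<^sub>2\<rbrakk> \<Longrightarrow> hinner ell2 f (g + h) = hinner ell2 f g + hinner ell2 f h"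
  by (subst (1 2 3) hinner_cnj) (simp add: hinner_add_left)

lemma hinner_scale_left: "hinner ell2 (\<lambda>i. c * f i) g = c * hinner ell2 f g"
  by (simp add: hinner_ell2 mult.assoc infsum_cmult_right')

lemma hinner_scale_right: "hinner ell2 f (\<lambda>i. c * g i) = cnj c * hinner ell2 f g"
  by (subst (1 2) hinner_cnj) (simp add: hinner_scale_left)

lemma hinner_zero_right: "hinner ell2 f 0 = 0"
  by (simp add: hinner_ell2)

lemma cmod_le_hnorm: "f \<in> \<L>\<^sub>2 \<Longrightarrow> cmod (f i) \<le> hnorm ell2 f"
  using L2_set_le_hnorm[of f "{i}"] by simp

lemma metric_space_ell2: "Metric_space \<L>\<^sub>2 (\<lambda>f g. hnorm ell2 (f - g))"
proof
  fix f g h :: "'i \<Rightarrow> complex"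
  show "0 \<le> hnorm ell2 (f - g)"
  proof (cases "(\<lambda>i. (f - g) i * cnj ((f - g) i)) summable_on UNIV")
    case True
    then have "Re (hinner ell2 (f - g) (f - g)) = (\<Sum>\<^sub>\<infinity>i. Re ((f - g) i * cnj ((f - g) i)))"
      unfolding hinner_ell2 by (rule infsum_Re[symmetric])
    also have "\<dots> \<ge> 0"
      by (rule infsum_nonneg) (simp only: Re_complex_of_real zero_le_power2 flip: complex_norm_square)
    finally show ?thesis
      by (simp add: hnorm_def)
  next
    case False
    then show ?thesis
      unfolding hnorm_def hinner_ell2 using infsum_not_exists[OF False] by simp
  qed
  show "hnorm ell2 (f - g) = hnorm ell2 (g - f)"
    by (simp add: hnorm_def hinner_ell2 algebra_simps)
  assume fg: "f \<in> \<L>\<^sub>2" "g \<in> \<L>\<^sub>2"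
  show "hnorm ell2 (f - g) = 0 \<longleftrightarrow> f = g"
  proof
    assume 0: "hnorm ell2 (f - g) = 0"
    show "f = g"
    proof
      fix i show "f i = g i"
        using cmod_le_hnorm[OF ell2_diff[OF fg], of i] 0 by simp
    qed
  qed (simp add: hnorm_def hinner_ell2)
  assume h: "h \<in> \<L>\<^sub>2"
  show "hnorm ell2 (f - h) \<le> hnorm ell2 (f - g) + hnorm ell2 (g - h)"
    using ell2_add(2)[OF ell2_diff[OF fg] ell2_diff[OF fg(2) h]] by simp
qed

text \<open>
  The candidate limit of a Cauchy sequence is its coordinatewise limit; the Cauchy estimate holds on
  every finite section and survives the passage to the limit there.
\<close>

lemma mcomplete_ell2:
  "Metric_space.mcomplete \<L>\<^sub>2 (\<lambda>f g. hnorm ell2 (f - g :: 'i \<Rightarrow> complex))"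
proof -
  interpret Metric_space "\<L>\<^sub>2" "\<lambda>f g. hnorm ell2 (f - g :: 'i \<Rightarrow> complex)"
    by (rule metric_space_ell2)
  show ?thesis
    unfolding mcomplete_def
  proof (intro allI impI)
    fix x :: "nat \<Rightarrow> 'i \<Rightarrow> complex"
    assume "MCauchy x"
    then have x: "\<And>n. x n \<in> \<L>\<^sub>2"
      and cauchy: "\<And>e. e > 0 \<Longrightarrow> \<exists>N. \<forall>m\<ge>N. \<forall>n\<ge>N. hnorm ell2 (x m - x n) < e"
      unfolding MCauchy_def by (auto simp: image_subset_iff)
    have "Cauchy (\<lambda>n. x n i)" for i
    proof (rule metric_CauchyI)
      fix e :: real assume "0 < e"
      then obtain N where N: "\<And>m n. m \<ge> N \<Longrightarrow> n \<ge> N \<Longrightarrow> hnorm ell2 (x m - x n) < e"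
        using cauchy by blast
      have "dist (x m i) (x n i) < e" if "m \<ge> N" "n \<ge> N" for m n
        using cmod_le_hnorm[OF ell2_diff[OF x x], of m n i] N[OF that] by (simp add: dist_norm)
      then show "\<exists>N. \<forall>m\<ge>N. \<forall>n\<ge>N. dist (x m i) (x n i) < e"
        by blast
    qed
    then obtain l where l: "\<And>i. (\<lambda>n. x n i) \<longlonglongrightarrow> l i"
      unfolding Cauchy_convergent_iff convergent_def by metis
    have close: "x n - l \<in> \<L>\<^sub>2 \<and> hnorm ell2 (x n - l) \<le> e"
      if N: "\<And>m n. m \<ge> N \<Longrightarrow> n \<ge> N \<Longrightarrow> hnorm ell2 (x m - x n) < e" and n: "n \<ge> N" for e N n
    proof -
      have "L2_set (\<lambda>i. cmod ((x n - l) i)) F \<le> e" if F: "finite F" for F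
      proof (rule LIMSEQ_le_const2)
        show "(\<lambda>m. L2_set (\<lambda>i. cmod ((x n - x m) i)) F) \<longlonglongrightarrow> L2_set (\<lambda>i. cmod ((x n - l) i)) F"
          unfolding L2_set_def fun_diff_def by (intro tendsto_intros l)
        show "\<exists>N. \<forall>m\<ge>N. L2_set (\<lambda>i. cmod ((x n - x m) i)) F \<le> e"
          using L2_set_le_hnorm[OF ell2_diff[OF x x] F] N n by (meson less_imp_le order_trans)
      qed
      then show ?thesis
        using ell2_boundedI by blast
    qed
    have "l \<in> \<L>\<^sub>2"
    proof -
      obtain N where "x N - l \<in> \<L>\<^sub>2"
        using cauchy[OF zero_less_one] close by blast
      then show ?thesis
        using ell2_diff[OF x[of N], of "x N - l"] by simp
    qed
    moreover have "\<exists>N. \<forall>n\<ge>N. x n \<in> \<L>\<^sub>2 \<and> hnorm ell2 (x n - l) < e" if "0 < e" for e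
    proof -
      obtain N where "\<And>m n. m \<ge> N \<Longrightarrow> n \<ge> N \<Longrightarrow> hnorm ell2 (x m - x n) < e / 2"
        using cauchy[of "e / 2"] \<open>0 < e\<close> by auto
      then have "hnorm ell2 (x n - l) \<le> e / 2" if "n \<ge> N" for n
        using close that by blast
      then have "hnorm ell2 (x n - l) < e" if "n \<ge> N" for n
        using that \<open>0 < e\<close> by fastforce
      then show ?thesis
        using x by auto
    qed
    ultimately show "\<exists>l. limitin mtopology x l sequentially"
      unfolding limit_metric_sequentially by blast
  qed
qed

lemma hilbert_space_ell2: "hilbert_space (ell2 :: ('i \<Rightarrow> complex) hspace)"
proof -
  interpret vector_space "hscale (ell2 :: ('i \<Rightarrow> complex) hspace)"
    by standard (auto simp: fun_eq_iff algebra_simps)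
  show ?thesis
  proof
    show "subspace \<L>\<^sub>2"
      by (auto simp: subspace_def ell2_zero ell2_add ell2_scale)
    show "hinner ell2 f f \<in> \<real>\<^sub>\<ge>\<^sub>0" if "f \<in> \<L>\<^sub>2" for f :: "'i \<Rightarrow> complex"
      using that by (simp add: hinner_self infsum_nonneg)
    show "f = 0" if "f \<in> \<L>\<^sub>2" "hinner ell2 f f = 0" for f :: "'i \<Rightarrow> complex"
      using that cmod_le_hnorm[of f] by (auto simp: hnorm_def fun_eq_iff)
  qed (auto simp: hinner_add_left hinner_scale_left mcomplete_ell2 intro: hinner_cnj)
qed

section \<open>Operators with an explicit adjoint\<close>

text \<open>
  The adjoint of an operator is defined by a description, whose existence would require the Riesz
  representation theorem. Carrying an explicit adjoint along avoids this: the relation is closed under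
  sums and compositions, so the adjoint of every operator below can be written down.
\<close>

definition adjoint_pair ::
    "(('i \<Rightarrow> complex) \<Rightarrow> ('j \<Rightarrow> complex)) \<Rightarrow> (('j \<Rightarrow> complex) \<Rightarrow> ('i \<Rightarrow> complex)) \<Rightarrow> bool" where
  "adjoint_pair T S \<longleftrightarrow> linear_map ell2 ell2 T
     \<and> (\<exists>B. \<forall>f\<in>\<L>\<^sub>2. hnorm ell2 (T f) \<le> B * hnorm ell2 f)
     \<and> (\<forall>g\<in>\<L>\<^sub>2. S g \<in> \<L>\<^sub>2)
     \<and> (\<forall>f\<in>\<L>\<^sub>2. \<forall>g\<in>\<L>\<^sub>2. hinner ell2 (T f) g = hinner ell2 f (S g))"

lemma adjoint_pair_maps:
  assumes "adjoint_pair T S"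
  shows "f \<in> \<L>\<^sub>2 \<Longrightarrow> T f \<in> \<L>\<^sub>2" "g \<in> \<L>\<^sub>2 \<Longrightarrow> S g \<in> \<L>\<^sub>2"
  using assms by (auto simp: adjoint_pair_def linear_map_def)

lemma adjoint_pair_bounded_op: "adjoint_pair T S \<Longrightarrow> bounded_op ell2 T"
  by (auto simp: adjoint_pair_def bounded_op_def)

lemma adjoint_pair_adj:
  assumes "adjoint_pair T S" "g \<in> \<L>\<^sub>2"
  shows "adj ell2 T g = S g"
  unfolding adj_def
proof (rule the_equality)
  show "S g \<in> \<L>\<^sub>2 \<and> (\<forall>f\<in>\<L>\<^sub>2. hinner ell2 (T f) g = hinner ell2 f (S g))"
    using assms by (auto simp: adjoint_pair_def)
  fix z assume z: "z \<in> \<L>\<^sub>2 \<and> (\<forall>f\<in>\<L>\<^sub>2. hinner ell2 (T f) g = hinner ell2 f z)"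
  have "hinner ell2 (ket i) z = hinner ell2 (ket i) (S g)" for i
    using z assms ket_in_ell2[of i] by (simp add: adjoint_pair_def)
  then have "hinner ell2 z (ket i) = hinner ell2 (S g) (ket i)" for i
    by (metis hinner_cnj)
  then show "z = S g"
    by (auto simp: hinner_ket)
qed

lemma adjoint_pair_compose:
  assumes "adjoint_pair T S" "adjoint_pair T' S'"
  shows "adjoint_pair (\<lambda>f. T' (T f)) (\<lambda>g. S (S' g))"
proof -
  obtain B B' where B: "\<And>f. f \<in> \<L>\<^sub>2 \<Longrightarrow> hnorm ell2 (T f) \<le> B * hnorm ell2 f"
    and B': "\<And>f. f \<in> \<L>\<^sub>2 \<Longrightarrow> hnorm ell2 (T' f) \<le> B' * hnorm ell2 f"
    using assms unfolding adjoint_pair_def by blast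
  have "hnorm ell2 (T' (T f)) \<le> (\<bar>B'\<bar> * B) * hnorm ell2 f" if f: "f \<in> \<L>\<^sub>2" for f
  proof -
    have Tf: "T f \<in> \<L>\<^sub>2"
      using adjoint_pair_maps(1)[OF assms(1) f] .
    have "hnorm ell2 (T' (T f)) \<le> \<bar>B'\<bar> * hnorm ell2 (T f)"
      using B'[OF Tf] hnorm_ell2_nonneg[OF Tf] by (meson abs_ge_self mult_right_mono order_trans)
    also have "\<dots> \<le> \<bar>B'\<bar> * (B * hnorm ell2 f)"
      using B[OF f] by (rule mult_left_mono) simp
    finally show ?thesis
      by (simp add: mult.assoc)
  qed
  then show ?thesis
    using assms adjoint_pair_maps[OF assms(1)] adjoint_pair_maps[OF assms(2)]
    unfolding adjoint_pair_def linear_map_def by (intro conjI ballI allI exI) auto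
qed

lemma adjoint_pair_add:
  assumes "adjoint_pair T S" "adjoint_pair T' S'"
  shows "adjoint_pair (\<lambda>f. T f + T' f) (\<lambda>g. S g + S' g)"
proof -
  obtain B B' where B: "\<And>f. f \<in> \<L>\<^sub>2 \<Longrightarrow> hnorm ell2 (T f) \<le> B * hnorm ell2 f"
    and B': "\<And>f. f \<in> \<L>\<^sub>2 \<Longrightarrow> hnorm ell2 (T' f) \<le> B' * hnorm ell2 f"
    using assms unfolding adjoint_pair_def by blast
  have maps: "T f \<in> \<L>\<^sub>2" "T' f \<in> \<L>\<^sub>2" if "f \<in> \<L>\<^sub>2" for f
    using that assms adjoint_pair_maps(1) by blast+
  have maps': "S f \<in> \<L>\<^sub>2" "S' f \<in> \<L>\<^sub>2" if "f \<in> \<L>\<^sub>2" for f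
    using that assms adjoint_pair_maps(2) by blast+
  have "hnorm ell2 (T f + T' f) \<le> (B + B') * hnorm ell2 f" if f: "f \<in> \<L>\<^sub>2" for f
    using ell2_add(2)[OF maps[OF f]] B[OF f] B'[OF f] by (simp add: distrib_right)
  moreover have "linear_map ell2 ell2 (\<lambda>f. T f + T' f)"
    using assms maps unfolding adjoint_pair_def linear_map_def
    by (auto simp: ell2_add fun_eq_iff algebra_simps)
  moreover have "hinner ell2 (T f + T' f) g = hinner ell2 f (S g + S' g)"
    if "f \<in> \<L>\<^sub>2" "g \<in> \<L>\<^sub>2" for f g
    using that assms maps maps'
    by (simp add: hinner_add_left hinner_add_right) (simp add: adjoint_pair_def)
  ultimately show ?thesis
    using maps' unfolding adjoint_pair_def by (blast intro: ell2_add)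
qed

text \<open>
  A partial injection of the index sets followed by multiplication with bounded weights. Shifts,
  reindexings and the diagonals of a band matrix are all of this form. The adjoint uses the
  inverse injection and the conjugate weights.
\<close>

lemma adjoint_pair_weighted_injection:
  fixes \<sigma> :: "'j \<Rightarrow> 'i" and w :: "'j \<Rightarrow> complex"
  assumes bij: "bij_betw \<sigma> D E" and inv: "\<And>j. j \<in> D \<Longrightarrow> \<tau> (\<sigma> j) = j"
    and w: "\<And>j. j \<in> D \<Longrightarrow> cmod (w j) \<le> C"
  shows "adjoint_pair (\<lambda>f j. if j \<in> D then w j * f (\<sigma> j) else 0)
                      (\<lambda>g i. if i \<in> E then cnj (w (\<tau> i)) * g (\<tau> i) else 0)"
    (is "adjoint_pair ?T ?S")
proof -
  have bij': "bij_betw \<tau> E D" and inv': "\<And>i. i \<in> E \<Longrightarrow> \<sigma> (\<tau> i) = i"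
    using bij inv by (auto simp: bij_betw_def inj_on_def image_iff)
  have bound: "(\<lambda>j. if j \<in> D then w j * f (\<sigma> j) else 0) \<in> \<L>\<^sub>2 \<and>
      hnorm ell2 (\<lambda>j. if j \<in> D then w j * f (\<sigma> j) else 0) \<le> \<bar>C\<bar> * hnorm ell2 f"
    if inj: "inj_on \<sigma> D" and w: "\<And>j. j \<in> D \<Longrightarrow> cmod (w j) \<le> C" and f: "f \<in> \<L>\<^sub>2"
    for \<sigma> :: "'u \<Rightarrow> 'v" and D w f
  proof -
    have "L2_set (\<lambda>j. cmod (if j \<in> D then w j * f (\<sigma> j) else 0)) F \<le> \<bar>C\<bar> * hnorm ell2 f"
      if F: "finite F" for F
    proof -
      have "L2_set (\<lambda>j. cmod (if j \<in> D then w j * f (\<sigma> j) else 0)) F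
          = L2_set (\<lambda>j. cmod (w j * f (\<sigma> j))) (F \<inter> D)"
        unfolding L2_set_def using F
        by (intro arg_cong[where f = sqrt] sum.mono_neutral_cong_right) auto
      also have "\<dots> \<le> L2_set (\<lambda>j. \<bar>C\<bar> * cmod (f (\<sigma> j))) (F \<inter> D)"
        using w by (intro L2_set_mono) (force simp: norm_mult intro: mult_right_mono)+
      also have "\<dots> = \<bar>C\<bar> * L2_set (\<lambda>j. cmod (f (\<sigma> j))) (F \<inter> D)"
        by (simp add: L2_set_right_distrib)
      also have "L2_set (\<lambda>j. cmod (f (\<sigma> j))) (F \<inter> D) = L2_set (\<lambda>i. cmod (f i)) (\<sigma> ` (F \<inter> D))"
        unfolding L2_set_def using inj by (subst sum.reindex) (auto intro: inj_on_subset)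
      also have "\<bar>C\<bar> * \<dots> \<le> \<bar>C\<bar> * hnorm ell2 f"
        using F f by (intro mult_left_mono L2_set_le_hnorm) auto
      finally show ?thesis .
    qed
    then show ?thesis
      using ell2_boundedI[of "\<lambda>j. if j \<in> D then w j * f (\<sigma> j) else 0" "\<bar>C\<bar> * hnorm ell2 f"]
      by simp
  qed
  have "\<forall>f\<in>\<L>\<^sub>2. ?T f \<in> \<L>\<^sub>2 \<and> hnorm ell2 (?T f) \<le> \<bar>C\<bar> * hnorm ell2 f"
    using bound[of \<sigma> D w] bij w by (auto simp: bij_betw_def)
  moreover have "\<forall>g\<in>\<L>\<^sub>2. ?S g \<in> \<L>\<^sub>2"
    using bound[of \<tau> E "\<lambda>i. cnj (w (\<tau> i))"] bij' w by (auto simp: bij_betw_def)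
  moreover have "hinner ell2 (?T f) g = hinner ell2 f (?S g)" for f g
  proof -
    have "hinner ell2 (?T f) g = (\<Sum>\<^sub>\<infinity>j\<in>D. w j * f (\<sigma> j) * cnj (g j))"
      unfolding hinner_ell2 by (rule infsum_cong_neutral) auto
    also have "\<dots> = (\<Sum>\<^sub>\<infinity>i\<in>E. w (\<tau> i) * f i * cnj (g (\<tau> i)))"
      by (subst infsum_reindex_bij_betw[OF bij', symmetric]) (simp add: inv' cong: infsum_cong)
    also have "\<dots> = hinner ell2 f (?S g)"
      unfolding hinner_ell2 by (rule infsum_cong_neutral) auto
    finally show ?thesis .
  qed
  moreover have "?T (f + g) = ?T f + ?T g" "?T (\<lambda>i. c * f i) = (\<lambda>j. c * ?T f j)" for f g c
    by (simp_all add: fun_eq_iff algebra_simps)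
  ultimately show ?thesis
    unfolding adjoint_pair_def linear_map_def hscale_ell2 by blast
qed

lemma normal_opI:
  assumes "adjoint_pair N M" and "\<And>f. f \<in> \<L>\<^sub>2 \<Longrightarrow> N (M f) = M (N f)"
  shows "normal_op ell2 N"
  using assms adjoint_pair_maps[OF assms(1)]
  by (simp add: normal_op_def adjoint_pair_bounded_op commutator_def adjoint_pair_adj[OF assms(1)])

lemma opnorm_nonneg:
  assumes "bounded_op ell2 T"
  shows "0 \<le> opnorm ell2 T"
proof -
  obtain B where B: "\<And>f. f \<in> \<L>\<^sub>2 \<Longrightarrow> hnorm ell2 (T f) \<le> B * hnorm ell2 f"
    and maps: "\<And>f. f \<in> \<L>\<^sub>2 \<Longrightarrow> T f \<in> \<L>\<^sub>2"
    using assms unfolding bounded_op_def linear_map_def Pi_iff by blast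
  have "hnorm ell2 (T f) \<le> \<bar>B\<bar>" if "f \<in> \<L>\<^sub>2" "hnorm ell2 f \<le> 1" for f
  proof -
    have "B * hnorm ell2 f \<le> \<bar>B\<bar> * 1"
      using that hnorm_ell2_nonneg[OF that(1)] by (intro mult_mono) auto
    then show ?thesis
      using B[OF that(1)] by simp
  qed
  then have "bdd_above ((\<lambda>f. hnorm ell2 (T f)) ` {f \<in> \<L>\<^sub>2. hnorm ell2 f \<le> 1})"
    by (intro bdd_aboveI2[where M = "\<bar>B\<bar>"]) auto
  moreover have "0 \<in> {f \<in> \<L>\<^sub>2. hnorm ell2 f \<le> 1}"
    using ell2_zero by (simp add: hnorm_def hinner_ell2)
  ultimately have "hnorm ell2 (T 0) \<le> opnorm ell2 T"
    unfolding opnorm_def by (intro cSUP_upper)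
  then show ?thesis
    using hnorm_ell2_nonneg[OF maps[OF ell2_zero]] by simp
qed

section \<open>Extensions and embeddings between sequence spaces\<close>

text \<open>
  A subnormal pair has its extension in the same ambient space, but the index set on which a normal
  extension is natural may be a different one. A bijection of the index sets transports the extension.
\<close>

lemma subnormal_pair_ell2I:
  fixes V :: "('j \<Rightarrow> complex) \<Rightarrow> ('i \<Rightarrow> complex)" and e :: "'j \<Rightarrow> 'i"
  assumes T: "bounded_op ell2 T1" "bounded_op ell2 T2"
    and e: "bij e"
    and V: "isometric_embedding ell2 ell2 V"
    and N1: "adjoint_pair N1 M1" "\<And>f. N1 (M1 f) = M1 (N1 f)"
    and N2: "adjoint_pair N2 M2" "\<And>f. N2 (M2 f) = M2 (N2 f)"
    and comm: "\<And>f. N1 (N2 f) = N2 (N1 f)"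
    and ext: "\<And>f. N1 (V f) = V (T1 f)" "\<And>f. N2 (V f) = V (T2 f)"
  shows "subnormal_pair ell2 T1 T2"
proof -
  define U :: "('i \<Rightarrow> complex) \<Rightarrow> ('j \<Rightarrow> complex)" where "U = (\<lambda>f j. f (e j))"
  define W :: "('j \<Rightarrow> complex) \<Rightarrow> ('i \<Rightarrow> complex)" where "W = (\<lambda>g i. g (inv e i))"
  have WU [simp]: "W (U f) = f" and UW [simp]: "U (W g) = g" for f g
    using e by (simp_all add: U_def W_def bij_def surj_f_inv_f)
  have UW_adj: "adjoint_pair U W"
    using adjoint_pair_weighted_injection[of e UNIV UNIV "inv e" "\<lambda>_. 1" 1] e
    by (simp add: U_def W_def bij_def)
  have WU_adj: "adjoint_pair W U"
    using adjoint_pair_weighted_injection[of "inv e" UNIV UNIV e "\<lambda>_. 1" 1] e bij_imp_bij_inv[OF e]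
    by (simp add: U_def W_def bij_def surj_f_inv_f)
  have transport: "normal_op ell2 (\<lambda>f. U (N (W f)))"
    if "adjoint_pair N M" "\<And>f. N (M f) = M (N f)" for N M
    using adjoint_pair_compose[OF adjoint_pair_compose[OF WU_adj that(1)] UW_adj]
    by (rule normal_opI) (simp add: that(2))
  have maps: "V f \<in> \<L>\<^sub>2" if "f \<in> \<L>\<^sub>2" for f
    using V that by (auto simp: isometric_embedding_def linear_map_def)
  have "linear_map ell2 ell2 (\<lambda>f. U (V f))"
    using V adjoint_pair_maps(1)[OF UW_adj]
    by (auto simp: isometric_embedding_def linear_map_def U_def)
  moreover have "hinner ell2 (U (V f)) (U (V g)) = hinner ell2 f g" if "f \<in> \<L>\<^sub>2" "g \<in> \<L>\<^sub>2" for f g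
    using UW_adj V maps that adjoint_pair_maps(1)[OF UW_adj]
    by (simp add: adjoint_pair_def isometric_embedding_def)
  ultimately have "isometric_embedding ell2 ell2 (\<lambda>f. U (V f))"
    by (simp add: isometric_embedding_def)
  moreover have "normal_pair ell2 (\<lambda>f. U (N1 (W f))) (\<lambda>f. U (N2 (W f)))"
    using transport[OF N1] transport[OF N2] by (simp add: normal_pair_def commutator_def comm)
  ultimately show ?thesis
    unfolding subnormal_pair_def using T hilbert_space_ell2
    by (intro conjI exI[of _ ell2] exI[of _ "\<lambda>f. U (V f)"] exI[of _ "\<lambda>f. U (N1 (W f))"]
        exI[of _ "\<lambda>f. U (N2 (W f))"]) (auto simp: ext)
qed

text \<open>
  By polarization it suffices to preserve norms, which involve only series of nonnegative terms.
\<close>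

lemma isometric_embeddingI_norm:
  assumes V: "linear_map ell2 ell2 V"
    and norm: "\<And>f. f \<in> \<L>\<^sub>2 \<Longrightarrow> hinner ell2 (V f) (V f) = hinner ell2 f f"
  shows "isometric_embedding ell2 ell2 V"
proof -
  have maps: "V f \<in> \<L>\<^sub>2" if "f \<in> \<L>\<^sub>2" for f
    using V that by (auto simp: linear_map_def)
  have polarization: "2 * hinner ell2 f g = (hinner ell2 (f + g) (f + g) - hinner ell2 f f - hinner ell2 g g)
      + \<i> * (hinner ell2 (f + (\<lambda>i. \<i> * g i)) (f + (\<lambda>i. \<i> * g i)) - hinner ell2 f f - hinner ell2 g g)"
    if "f \<in> \<L>\<^sub>2" "g \<in> \<L>\<^sub>2" for f g :: "'k \<Rightarrow> complex"
    using that
    by (simp add: hinner_add_left hinner_add_right hinner_scale_left hinner_scale_right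
        ell2_add ell2_scale algebra_simps)
  have "hinner ell2 (V f) (V g) = hinner ell2 f g" if fg: "f \<in> \<L>\<^sub>2" "g \<in> \<L>\<^sub>2" for f g
  proof -
    have "V (f + g) = V f + V g" "V (f + (\<lambda>i. \<i> * g i)) = V f + (\<lambda>i. \<i> * V g i)"
      using V fg ell2_scale(1)[OF fg(2)] by (simp_all add: linear_map_def)
    then have "2 * hinner ell2 (V f) (V g) = 2 * hinner ell2 f g"
      using fg norm[OF ell2_add(1)[OF fg]] norm[OF ell2_add(1)[OF fg(1) ell2_scale(1)[OF fg(2)], of "\<i>"]]
      by (simp only: polarization maps norm)
    then show ?thesis
      by simp
  qed
  then show ?thesis
    using V by (simp add: isometric_embedding_def)
qed

section \<open>Hyponormality of the shifts\<close>

lemma adjoint_pair_shift1: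
  assumes "bounded (range \<alpha>)"
  shows "adjoint_pair (shift1 \<alpha>) (\<lambda>g (m, n). of_real (\<alpha> (m, n)) * g (Suc m, n))"
proof -
  obtain C where C: "\<And>k. \<bar>\<alpha> k\<bar> \<le> C"
    using assms by (auto simp: bounded_iff)
  have "adjoint_pair (\<lambda>f k. if k \<in> range Suc \<times> UNIV
            then of_real (\<alpha> (fst k - 1, snd k)) * f (fst k - 1, snd k) else 0)
          (\<lambda>g k. if k \<in> UNIV then cnj (of_real (\<alpha> (fst (Suc (fst k), snd k) - 1, snd (Suc (fst k), snd k))))
            * g (Suc (fst k), snd k) else 0)"
    by (rule adjoint_pair_weighted_injection[where C = C])
       (force simp: C intro!: bij_betw_byWitness[where f' = "\<lambda>k. (Suc (fst k), snd k)"])+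
  also have "(\<lambda>f k. if k \<in> range Suc \<times> UNIV
      then of_real (\<alpha> (fst k - 1, snd k)) * f (fst k - 1, snd k) else 0) = shift1 \<alpha>"
    by (auto simp: fun_eq_iff shift1_def split: nat.split prod.split)
  finally show ?thesis
    by (simp add: case_prod_beta')
qed

lemma adjoint_pair_shift2:
  assumes "bounded (range \<beta>)"
  shows "adjoint_pair (shift2 \<beta>) (\<lambda>g (m, n). of_real (\<beta> (m, n)) * g (m, Suc n))"
proof -
  obtain C where C: "\<And>k. \<bar>\<beta> k\<bar> \<le> C"
    using assms by (auto simp: bounded_iff)
  have "adjoint_pair (\<lambda>f k. if k \<in> UNIV \<times> range Suc
            then of_real (\<beta> (fst k, snd k - 1)) * f (fst k, snd k - 1) else 0)
          (\<lambda>g k. if k \<in> UNIV then cnj (of_real (\<beta> (fst (fst k, Suc (snd k)), snd (fst k, Suc (snd k)) - 1)))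
            * g (fst k, Suc (snd k)) else 0)"
    by (rule adjoint_pair_weighted_injection[where C = C])
       (force simp: C intro!: bij_betw_byWitness[where f' = "\<lambda>k. (fst k, Suc (snd k))"])+
  also have "(\<lambda>f k. if k \<in> UNIV \<times> range Suc
      then of_real (\<beta> (fst k, snd k - 1)) * f (fst k, snd k - 1) else 0) = shift2 \<beta>"
    by (auto simp: fun_eq_iff shift2_def split: nat.split prod.split)
  finally show ?thesis
    by (simp add: case_prod_beta')
qed

text \<open>
  At \<open>0 \<oplus> e\<close> with a basis vector \<open>e\<close> the operator matrix is the self-commutator of the second shift
  at \<open>e\<close>, whose value is the squared weight leaving \<open>e\<close> minus the one arriving at \<open>e\<close>.
\<close>

lemma hyponormal_shift2_weights_mono:
  assumes "bounded (range \<alpha>)" "bounded (range \<beta>)"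
    and hyp: "hyponormal_pair ell2 (shift1 \<alpha>) (shift2 \<beta>)"
  shows "(\<beta> (m, n))\<^sup>2 \<le> (\<beta> (m, Suc n))\<^sup>2"
proof -
  note adj1 = adjoint_pair_adj[OF adjoint_pair_shift1[OF assms(1)]]
  note adj2 = adjoint_pair_adj[OF adjoint_pair_shift2[OF assms(2)]]
  let ?x = "ket (m, Suc n)"
  have zero: "shift1 \<alpha> 0 = 0" "shift2 \<beta> 0 = 0"
    by (auto simp: fun_eq_iff shift1_def shift2_def split: nat.split)
  let ?A = "op_matrix (commutator (adj ell2 (shift1 \<alpha>)) (shift1 \<alpha>)) (commutator (adj ell2 (shift2 \<beta>)) (shift1 \<alpha>))
                    (commutator (adj ell2 (shift1 \<alpha>)) (shift2 \<beta>)) (commutator (adj ell2 (shift2 \<beta>)) (shift2 \<beta>))"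
  have "(0, ?x) \<in> hcarrier (hsum ell2 ell2)"
    by (simp add: hsum_def ell2_zero ket_in_ell2)
  then have pos: "hinner (hsum ell2 ell2) (?A (0, ?x)) (0, ?x) \<in> \<real>\<^sub>\<ge>\<^sub>0"
    using hyp unfolding hyponormal_pair_def positive_op_def by blast
  have "commutator (adj ell2 (shift1 \<alpha>)) (shift2 \<beta>) 0 = 0"
    by (auto simp: commutator_def adj1 ell2_zero zero fun_eq_iff shift2_def split: nat.split)
  moreover have "commutator (adj ell2 (shift2 \<beta>)) (shift2 \<beta>) ?x (m, Suc n)
      = of_real ((\<beta> (m, Suc n))\<^sup>2 - (\<beta> (m, n))\<^sup>2)"
    using adjoint_pair_maps(1)[OF adjoint_pair_shift2[OF assms(2)] ket_in_ell2, of "(m, Suc n)"]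
    by (simp add: commutator_def adj2 ket_in_ell2) (simp add: shift2_def ket_def power2_eq_square)
  ultimately have "hinner (hsum ell2 ell2) (?A (0, ?x)) (0, ?x) = of_real ((\<beta> (m, Suc n))\<^sup>2 - (\<beta> (m, n))\<^sup>2)"
    by (simp add: hsum_def op_matrix_def hinner_zero_right hinner_ket)
  with pos have "complex_of_real ((\<beta> (m, Suc n))\<^sup>2 - (\<beta> (m, n))\<^sup>2) \<in> \<real>\<^sub>\<ge>\<^sub>0"
    by (simp only:)
  then show ?thesis
    by (simp only: nonneg_Reals_of_real_iff diff_ge_0_iff_ge)
qed

section \<open>Orthonormal polynomials and the Jacobi matrix\<close>

text \<open>
  What remains of the form \<open>\<integral> p q d\<rho>\<close> of a positive measure on \<open>[-1, 1]\<close> when the measure is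
  forgotten. The form is degenerate if the measure has finite support.
\<close>

locale moment_form =
  fixes B :: "real poly \<Rightarrow> real poly \<Rightarrow> real"
  assumes add_left: "B (p + q) r = B p r + B q r"
    and smult_left: "B (smult c p) r = c * B p r"
    and sym: "B p q = B q p"
    and nonneg: "0 \<le> B p p"
    and X_sym: "B (pCons 0 p) q = B p (pCons 0 q)"
    and X_contractive: "B (pCons 0 p) (pCons 0 p) \<le> B p p"
begin

lemma add_right: "B r (p + q) = B r p + B r q"
  by (metis add_left sym)

lemma smult_right: "B r (smult c p) = c * B r p"
  by (metis smult_left sym)

lemma sum_left: "B (\<Sum>i\<in>A. f i) r = (\<Sum>i\<in>A. B (f i) r)"
  using smult_left[of 0 0 r] by (induction A rule: infinite_finite_induct) (auto simp: add_left)

lemma diff_left: "B (p - q) r = B p r - B q r"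
  using add_left[of "p - q" q r] by simp

lemma cauchy_schwarz: "(B p q)\<^sup>2 \<le> B p p * B q q"
proof -
  have "0 \<le> B (smult s p + smult t q) (smult s p + smult t q)" for s t
    by (rule nonneg)
  then have quad: "0 \<le> s\<^sup>2 * B p p + 2 * s * t * B p q + t\<^sup>2 * B q q" for s t
    by (simp add: add_left add_right smult_left smult_right sym[of q p] power2_eq_square algebra_simps)
  show ?thesis
  proof (cases "B q q = 0")
    case True
    \<comment> \<open>Here the quadratic form is affine in \<open>t\<close>, and it is bounded below only if the slope vanishes.\<close>
    have "B p q = 0"
    proof (rule ccontr)
      assume "B p q \<noteq> 0"
      then show False
        using quad[of 1 "- (B p p + 1) / (2 * B p q)"] True nonneg[of p] by (simp add: field_simps)
    qed
    then show ?thesis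
      using True by simp
  next
    case False
    then have pos: "0 < B q q"
      using nonneg[of q] by simp
    have "0 \<le> B q q * (B p p * B q q - (B p q)\<^sup>2)"
      using quad[of "B q q" "- B p q"] by (simp add: power2_eq_square algebra_simps)
    then show ?thesis
      using pos by (simp add: zero_le_mult_iff)
  qed
qed

lemma null_left: "B p p = 0 \<Longrightarrow> B p q = 0"
  using cauchy_schwarz[of p q] by simp

text \<open>
  Gram-Schmidt applied to the monomials. If a residual has norm zero, \<open>1 / sqrt 0 = 0\<close> makes the
  corresponding polynomial zero, so degenerate forms need no separate treatment.
\<close>

fun orth :: "nat \<Rightarrow> real poly" where
  "orth n = (let q = monom 1 n - (\<Sum>k<n. smult (B (monom 1 n) (orth k)) (orth k))
             in smult (1 / sqrt (B q q)) q)"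

declare orth.simps [simp del]

definition resid :: "nat \<Rightarrow> real poly" where
  "resid n = monom 1 n - (\<Sum>k<n. smult (B (monom 1 n) (orth k)) (orth k))"

lemma orth_resid: "orth n = smult (1 / sqrt (B (resid n) (resid n))) (resid n)"
  by (subst orth.simps) (simp add: resid_def Let_def)

lemma orth_self: "B (orth n) (orth n) = (if B (resid n) (resid n) = 0 then 0 else 1)"
  using nonneg[of "resid n"] by (simp add: orth_resid smult_left smult_right)

lemma resid_left: "B (resid n) r = sqrt (B (resid n) (resid n)) * B (orth n) r"
  by (cases "B (resid n) (resid n) = 0") (auto simp: orth_resid smult_left null_left)

text \<open>
  \<open>orth k\<close> has norm \<open>1\<close> or is null; in both cases projecting twice is projecting once.
\<close>

lemma orth_absorb: "B p (orth k) * B (orth k) (orth k) = B p (orth k)"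
proof (cases "B (orth k) (orth k) = 0")
  case True
  then show ?thesis
    using null_left[OF True, of p] by (simp add: sym[of p])
qed (auto simp: orth_self split: if_splits)

lemma orth_orth:
  assumes "j \<noteq> k" shows "B (orth j) (orth k) = 0"
proof -
  have "k < n \<Longrightarrow> B (orth n) (orth k) = 0" for n k
  proof (induction n arbitrary: k rule: less_induct)
    case (less n)
    have "(\<Sum>l<n. B (monom 1 n) (orth l) * B (orth l) (orth k))
        = (\<Sum>l\<in>{k}. B (monom 1 n) (orth l) * B (orth l) (orth k))"
    proof (rule sum.mono_neutral_right)
      show "\<forall>l\<in>{..<n} - {k}. B (monom 1 n) (orth l) * B (orth l) (orth k) = 0"
      proof
        fix l assume "l \<in> {..<n} - {k}"
        then have "B (orth l) (orth k) = 0"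
          using less.IH[of l k] less.IH[of k l] less.prems sym[of "orth l" "orth k"]
          by (cases l k rule: linorder_cases) auto
        then show "B (monom 1 n) (orth l) * B (orth l) (orth k) = 0"
          by simp
      qed
    qed (use less.prems in auto)
    then have "B (resid n) (orth k) = 0"
      by (simp add: resid_def diff_left sum_left smult_left orth_absorb)
    then show ?case
      by (simp add: orth_resid smult_left)
  qed
  then show ?thesis
    using assms sym[of "orth j" "orth k"] by (cases j k rule: linorder_cases) auto
qed

lemma degree_orth: "degree (orth n) \<le> n"
proof (induction n rule: less_induct)
  case (less n)
  have "degree (\<Sum>k<n. smult (B (monom 1 n) (orth k)) (orth k)) \<le> n"
  proof (rule degree_sum_le)
    fix k assume "k \<in> {..<n}"
    then show "degree (smult (B (monom 1 n) (orth k)) (orth k)) \<le> n"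
      using less[of k] degree_smult_le[of "B (monom 1 n) (orth k)" "orth k"] by simp
  qed simp
  then have "degree (resid n) \<le> n"
    unfolding resid_def by (intro degree_diff_le) (auto simp: degree_monom_eq)
  then show ?case
    by (metis orth_resid degree_smult_le order_trans)
qed

text \<open>
  The residual is a multiple of \<open>orth m\<close> modulo vectors of norm zero, so the form cannot distinguish a
  monomial from its orthogonal expansion.
\<close>

lemma expand_monom: "B (monom 1 m) r = (\<Sum>k\<le>m. B (monom 1 m) (orth k) * B (orth k) r)"
proof -
  let ?s = "sqrt (B (resid m) (resid m))"
  have monom: "monom 1 m = resid m + (\<Sum>k<m. smult (B (monom 1 m) (orth k)) (orth k))"
    by (simp add: resid_def)
  have expand: "B (monom 1 m) r = ?s * B (orth m) r + (\<Sum>k<m. B (monom 1 m) (orth k) * B (orth k) r)" for r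
    using arg_cong[OF monom, of "\<lambda>p. B p r"] resid_left[of m r]
    by (simp only: add_left sum_left smult_left)
  have "B (monom 1 m) (orth m) = ?s * B (orth m) (orth m)"
    using expand[of "orth m"] by (simp add: orth_orth)
  also have "\<dots> = ?s"
    by (simp add: orth_self)
  finally show ?thesis
    by (subst expand) (simp add: lessThan_Suc_atMost[symmetric])
qed

lemma monom_orth_eq_0: "m < k \<Longrightarrow> B (monom 1 m) (orth k) = 0"
  by (subst expand_monom) (simp add: orth_orth)

lemma poly_as_sum: "degree p \<le> n \<Longrightarrow> p = (\<Sum>i\<le>n. smult (coeff p i) (monom 1 i))" for p :: "real poly"
  using poly_as_sum_of_monoms'[of p n] by (simp add: smult_monom)

lemma poly_orth_eq_0:
  assumes "degree p < k"
  shows "B p (orth k) = 0"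
  by (subst poly_as_sum[OF order_refl]) (use assms in \<open>simp add: sum_left smult_left monom_orth_eq_0\<close>)

lemma orth_shift_eq_0:
  assumes "Suc j < k \<or> Suc k < j"
  shows "B (pCons 0 (orth j)) (orth k) = 0"
proof -
  have *: "B (pCons 0 (orth j)) (orth k) = 0" if "Suc j < k" for j k
    using that degree_orth[of j] degree_pCons_le[of 0 "orth j"] by (intro poly_orth_eq_0) linarith
  from assms show ?thesis
  proof
    assume "Suc k < j"
    then show ?thesis
      using *[of k j] by (simp add: X_sym sym[of "orth j"])
  qed (rule *)
qed

lemma abs_orth_shift_le_1: "\<bar>B (pCons 0 (orth j)) (orth k)\<bar> \<le> 1"
proof -
  have "B (pCons 0 (orth j)) (pCons 0 (orth j)) \<le> 1"
    using X_contractive[of "orth j"] by (auto simp: orth_self split: if_splits)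
  moreover have "B (orth k) (orth k) \<le> 1"
    by (simp add: orth_self)
  ultimately have "(B (pCons 0 (orth j)) (orth k))\<^sup>2 \<le> 1"
    using cauchy_schwarz[of "pCons 0 (orth j)" "orth k"] nonneg
    by (meson mult_le_one order_trans)
  then show ?thesis
    by (simp add: abs_square_le_1)
qed

text \<open>
  The orthonormal coordinates of the monomials are generated by a bounded symmetric tridiagonal
  matrix: multiplication by the variable raises the degree by at most one, and by symmetry lowers
  the index by at most one. The last equation is Parseval's identity.
\<close>

theorem jacobi_matrix:
  obtains a b :: "nat \<Rightarrow> real" and c :: "nat \<Rightarrow> nat \<Rightarrow> real"
  where "\<And>j. \<bar>a j\<bar> \<le> 1" "\<And>j. \<bar>b j\<bar> \<le> 1"
    and "\<And>m j. c (Suc m) j = a j * c m j + b j * c m (Suc j) + (if j = 0 then 0 else b (j - 1) * c m (j - 1))"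
    and "\<And>m j. m < j \<Longrightarrow> c m j = 0"
    and "\<And>m. (\<Sum>j\<le>m. (c m j)\<^sup>2) = B (monom 1 m) (monom 1 m)"
proof
  define a where "a = (\<lambda>j. B (pCons 0 (orth j)) (orth j))"
  define b where "b = (\<lambda>j. B (pCons 0 (orth j)) (orth (Suc j)))"
  define c where "c = (\<lambda>m j. B (monom 1 m) (orth j))"
  show "\<bar>a j\<bar> \<le> 1" "\<bar>b j\<bar> \<le> 1" for j
    by (simp_all add: a_def b_def abs_orth_shift_le_1)
  show zero: "c m j = 0" if "m < j" for m j
    using that by (simp add: c_def monom_orth_eq_0)
  show "(\<Sum>j\<le>m. (c m j)\<^sup>2) = B (monom 1 m) (monom 1 m)" for m
    by (subst expand_monom) (simp add: c_def power2_eq_square sym[of "orth _" "monom 1 m"])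
  show "c (Suc m) j = a j * c m j + b j * c m (Suc j) + (if j = 0 then 0 else b (j - 1) * c m (j - 1))"
    for m j
  proof -
    let ?g = "\<lambda>k. B (monom 1 m) (orth k) * B (orth k) (pCons 0 (orth j))"
    let ?N = "{j - 1, j, Suc j}"
    have swap: "B (pCons 0 (orth (Suc i))) (orth i) = B (pCons 0 (orth i)) (orth (Suc i))" for i
      by (simp only: X_sym sym[of "orth (Suc i)" "pCons 0 (orth i)"])
    have "c (Suc m) j = B (monom 1 m) (pCons 0 (orth j))"
      by (simp add: c_def monom_Suc X_sym)
    also have "\<dots> = (\<Sum>k\<le>m. ?g k)"
      by (rule expand_monom)
    also have "\<dots> = (\<Sum>k\<in>{..m} \<union> ?N. ?g k)"
      by (rule sum.mono_neutral_left) (auto simp: monom_orth_eq_0)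
    also have "\<dots> = (\<Sum>k\<in>?N. ?g k)"
    proof (rule sum.mono_neutral_right)
      show "\<forall>k\<in>{..m} \<union> ?N - ?N. ?g k = 0"
      proof
        fix k assume "k \<in> {..m} \<union> ?N - ?N"
        then have "Suc j < k \<or> Suc k < j"
          by (cases j) auto
        then show "?g k = 0"
          using orth_shift_eq_0[of j k] by (simp add: sym[of "orth k"])
      qed
    qed auto
    also have "\<dots> = a j * c m j + b j * c m (Suc j) + (if j = 0 then 0 else b (j - 1) * c m (j - 1))"
      by (cases j) (simp_all add: a_def b_def c_def swap flip: X_sym)
    finally show ?thesis .
  qed
qed

end

section \<open>Removing an atom from a measure\<close>

text \<open>
  On \<open>[0, 1]\<close> the powers \<open>s\<^sup>n\<close> decrease to the indicator of \<open>1\<close>, so the moments converge to the mass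
  of this point.
\<close>

lemma measure_atom_at_1_ge:
  fixes \<nu> :: "real measure"
  assumes "prob_space \<nu>" and sets: "sets \<nu> = sets borel" and supp: "AE s in \<nu>. s \<in> {0..1}"
    and bound: "\<And>n. t \<le> (\<integral>s. s ^ n \<partial>\<nu>)"
  shows "t \<le> measure \<nu> {1}"
proof -
  interpret prob_space \<nu> by fact
  have "(\<lambda>n. \<integral>s. s ^ n \<partial>\<nu>) \<longlonglongrightarrow> (\<integral>s. indicator {1} s \<partial>\<nu>)"
  proof (rule integral_dominated_convergence[where w = "\<lambda>_. 1"])
    show "AE s in \<nu>. (\<lambda>n. s ^ n) \<longlonglongrightarrow> indicator {1} s"
      using supp
    proof (rule AE_mp, intro AE_I2 impI)
      fix s :: real assume "s \<in> {0..1}"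
      then show "(\<lambda>n. s ^ n) \<longlonglongrightarrow> indicator {1} s"
        by (cases "s = 1") (auto intro: LIMSEQ_realpow_zero)
    qed
    show "AE s in \<nu>. norm (s ^ n) \<le> 1" for n
      using supp by (rule AE_mp) (auto simp: power_le_one)
  qed (auto simp: measurable_cong_sets[OF sets refl] sets)
  then have "t \<le> (\<integral>s. indicator {1} s \<partial>\<nu>)"
    using bound by (intro LIMSEQ_le_const) auto
  then show ?thesis
    by (simp add: sets sets_eq_imp_space_eq[OF sets])
qed

text \<open>
  This is the form of \<open>\<nu>\<close> with mass \<open>t\<close> removed at \<open>1\<close>, and what remains is a positive measure by the
  assumption on \<open>t\<close>. Polynomials are taken in \<open>sqrt s\<close> because the extension acts by
  multiplication with \<open>sqrt s\<close>, the positive square root of the moment variable.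
\<close>

lemma moment_form_minus_atom:
  fixes \<nu> :: "real measure"
  assumes "prob_space \<nu>" and sets: "sets \<nu> = sets borel" and supp: "AE s in \<nu>. s \<in> {0..1}"
    and t: "t \<le> measure \<nu> {1}"
  shows "moment_form (\<lambda>p q. (\<integral>s. poly p (sqrt s) * poly q (sqrt s) \<partial>\<nu>) - t * (poly p 1 * poly q 1))"
proof -
  interpret prob_space \<nu> by fact
  have int: "integrable \<nu> (\<lambda>s. poly p (sqrt s))" for p :: "real poly"
  proof -
    have "compact (poly p ` {0..1})"
      by (intro compact_continuous_image continuous_intros) auto
    then obtain C where C: "\<And>r. r \<in> {0..1} \<Longrightarrow> norm (poly p r) \<le> C"
      unfolding compact_eq_bounded_closed bounded_iff by (meson imageI)
    show ?thesis
    proof (rule integrable_const_bound)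
      show "AE s in \<nu>. norm (poly p (sqrt s)) \<le> C"
        using supp by (rule AE_mp) (intro AE_I2 impI C, simp)
      have "continuous_on UNIV (\<lambda>s. poly p (sqrt s))"
        by (intro continuous_intros)
      then show "(\<lambda>s. poly p (sqrt s)) \<in> borel_measurable \<nu>"
        unfolding measurable_cong_sets[OF sets refl] by (rule borel_measurable_continuous_onI)
    qed
  qed
  have int2: "integrable \<nu> (\<lambda>s. poly p (sqrt s) * poly q (sqrt s))" for p q :: "real poly"
    using int[of "p * q"] by simp
  have atom: "t * (poly p 1)\<^sup>2 \<le> (\<integral>s. (poly p (sqrt s))\<^sup>2 \<partial>\<nu>)" for p :: "real poly"
  proof -
    have "t * (poly p 1)\<^sup>2 \<le> measure \<nu> {1} * (poly p 1)\<^sup>2"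
      using t by (rule mult_right_mono) simp
    also have "\<dots> = (\<integral>s. indicator {1} s * (poly p 1)\<^sup>2 \<partial>\<nu>)"
      by (simp add: sets sets_eq_imp_space_eq[OF sets])
    also have "\<dots> \<le> (\<integral>s. (poly p (sqrt s))\<^sup>2 \<partial>\<nu>)"
    proof (rule integral_mono)
      show "integrable \<nu> (\<lambda>s. indicator {1} s * (poly p 1)\<^sup>2)"
        by (intro integrable_mult_left integrable_real_indicator) (auto simp: sets emeasure_eq_measure)
      show "integrable \<nu> (\<lambda>s. (poly p (sqrt s))\<^sup>2)"
        using int2[of p p] by (simp add: power2_eq_square)
    qed (auto simp: indicator_def)
    finally show ?thesis .
  qed
  show ?thesis
  proof
    fix p q r :: "real poly" and c :: real
    show "(\<integral>s. poly (p + q) (sqrt s) * poly r (sqrt s) \<partial>\<nu>) - t * (poly (p + q) 1 * poly r 1)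
        = (\<integral>s. poly p (sqrt s) * poly r (sqrt s) \<partial>\<nu>) - t * (poly p 1 * poly r 1)
        + ((\<integral>s. poly q (sqrt s) * poly r (sqrt s) \<partial>\<nu>) - t * (poly q 1 * poly r 1))"
      by (simp add: distrib_right int2 algebra_simps Bochner_Integration.integral_add)
    show "(\<integral>s. poly (smult c p) (sqrt s) * poly r (sqrt s) \<partial>\<nu>) - t * (poly (smult c p) 1 * poly r 1)
        = c * ((\<integral>s. poly p (sqrt s) * poly r (sqrt s) \<partial>\<nu>) - t * (poly p 1 * poly r 1))"
      by (simp add: mult.assoc right_diff_distrib)
    show "(\<integral>s. poly p (sqrt s) * poly q (sqrt s) \<partial>\<nu>) - t * (poly p 1 * poly q 1)
        = (\<integral>s. poly q (sqrt s) * poly p (sqrt s) \<partial>\<nu>) - t * (poly q 1 * poly p 1)"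
      by (simp add: mult.commute)
    show "0 \<le> (\<integral>s. poly p (sqrt s) * poly p (sqrt s) \<partial>\<nu>) - t * (poly p 1 * poly p 1)"
      using atom[of p] by (simp add: power2_eq_square)
    show "(\<integral>s. poly (pCons 0 p) (sqrt s) * poly q (sqrt s) \<partial>\<nu>) - t * (poly (pCons 0 p) 1 * poly q 1)
        = (\<integral>s. poly p (sqrt s) * poly (pCons 0 q) (sqrt s) \<partial>\<nu>) - t * (poly p 1 * poly (pCons 0 q) 1)"
      by (simp add: mult.left_commute mult.assoc)
    have "(\<integral>s. poly (pCons 0 p) (sqrt s) * poly (pCons 0 p) (sqrt s) \<partial>\<nu>)
        \<le> (\<integral>s. poly p (sqrt s) * poly p (sqrt s) \<partial>\<nu>)"
    proof (rule integral_mono_AE[OF int2 int2])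
      show "AE s in \<nu>. poly (pCons 0 p) (sqrt s) * poly (pCons 0 p) (sqrt s) \<le> poly p (sqrt s) * poly p (sqrt s)"
        using supp
      proof (rule AE_mp, intro AE_I2 impI)
        fix s :: real assume s: "s \<in> {0..1}"
        have "poly (pCons 0 p) (sqrt s) * poly (pCons 0 p) (sqrt s) = (sqrt s * sqrt s) * (poly p (sqrt s))\<^sup>2"
          by (simp add: power2_eq_square mult_ac del: real_sqrt_mult_self)
        also have "\<dots> \<le> 1 * (poly p (sqrt s))\<^sup>2"
          using s by (intro mult_right_mono) auto
        finally show "poly (pCons 0 p) (sqrt s) * poly (pCons 0 p) (sqrt s) \<le> poly p (sqrt s) * poly p (sqrt s)"
          by (simp add: power2_eq_square)
      qed
    qed
    then show "(\<integral>s. poly (pCons 0 p) (sqrt s) * poly (pCons 0 p) (sqrt s) \<partial>\<nu>)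
          - t * (poly (pCons 0 p) 1 * poly (pCons 0 p) 1)
        \<le> (\<integral>s. poly p (sqrt s) * poly p (sqrt s) \<partial>\<nu>) - t * (poly p 1 * poly p 1)"
      by simp
  qed
qed

lemma monom_sqrt_integral:
  fixes \<nu> :: "real measure"
  assumes sets: "sets \<nu> = sets borel" and supp: "AE s in \<nu>. s \<in> {0..1}"
  shows "(\<integral>s. poly (monom 1 m) (sqrt s) * poly (monom 1 m) (sqrt s) \<partial>\<nu>) = (\<integral>s. s ^ m \<partial>\<nu>)"
proof (rule integral_cong_AE)
  show "AE s in \<nu>. poly (monom 1 m) (sqrt s) * poly (monom 1 m) (sqrt s) = s ^ m"
    using supp by (rule AE_mp) (auto simp: poly_monom simp flip: power_mult_distrib)
qed (auto simp: measurable_cong_sets[OF sets refl] poly_monom)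

section \<open>The normal extension\<close>

text \<open>
  The families indexed by \<open>int \<times> (nat + int)\<close> form the space
  \<open>\<ell>\<^sup>2(\<int>) \<otimes> (\<ell>\<^sup>2(\<nat>) \<oplus> \<ell>\<^sup>2(\<int>))\<close>, on which these operators are
  \<open>S\<^sup>d \<otimes> (J \<oplus> 1)\<close> and \<open>1 \<otimes> (0 \<oplus> S\<^sup>d)\<close>, with \<open>S\<close> the bilateral shift and \<open>J\<close> the Jacobi matrix with
  diagonal \<open>a\<close> and off-diagonal \<open>b\<close>. The power \<open>d\<close> is a parameter so that the adjoints, given by \<open>- d\<close>,
  are instances of the same definitions.
\<close>

definition jacobi_shift ::
    "(nat \<Rightarrow> real) \<Rightarrow> (nat \<Rightarrow> real) \<Rightarrow> int \<Rightarrow> (int \<times> (nat + int) \<Rightarrow> complex) \<Rightarrow> int \<times> (nat + int) \<Rightarrow> complex" where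
  "jacobi_shift a b d f = (\<lambda>(m, x). case x of
      Inl j \<Rightarrow> a j * f (m - d, Inl j) + b j * f (m - d, Inl (Suc j))
        + (if j = 0 then 0 else b (j - 1) * f (m - d, Inl (j - 1)))
    | Inr n \<Rightarrow> f (m - d, Inr n))"

definition fibre_shift :: "int \<Rightarrow> (int \<times> (nat + int) \<Rightarrow> complex) \<Rightarrow> int \<times> (nat + int) \<Rightarrow> complex" where
  "fibre_shift d f = (\<lambda>(m, x). case x of Inl j \<Rightarrow> 0 | Inr n \<Rightarrow> f (m, Inr (n - d)))"

text \<open>
  The three diagonals of the Jacobi matrix are weighted injections; taking adjoints exchanges the
  upper and the lower one. The diagonal also carries the identity on the other summand.
\<close>

lemma adjoint_pair_jacobi_shift:
  assumes a: "\<And>j. \<bar>a j\<bar> \<le> 1" and b: "\<And>j. \<bar>b j\<bar> \<le> 1"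
  shows "adjoint_pair (jacobi_shift a b d) (jacobi_shift a b (- d))"
proof -
  \<comment> \<open>The value at \<open>Inr\<close> is a dummy: wherever \<open>?idx\<close> occurs, the guards exclude these indices.\<close>
  let ?idx = "\<lambda>x :: nat + int. case x of Inl j \<Rightarrow> j | Inr _ \<Rightarrow> 0"
  have diag: "adjoint_pair
      (\<lambda>f k. if k \<in> UNIV then (case snd k of Inl j \<Rightarrow> of_real (a j) | Inr _ \<Rightarrow> 1) * f (fst k - d, snd k) else 0)
      (\<lambda>f k. if k \<in> UNIV then cnj (case snd (fst k + d, snd k) of Inl j \<Rightarrow> of_real (a j) | Inr _ \<Rightarrow> 1)
          * f (fst k + d, snd k) else 0)"
    by (rule adjoint_pair_weighted_injection[where C = 1])
       (auto simp: a split: sum.split intro!: bij_betw_byWitness[where f' = "\<lambda>k. (fst k + d, snd k)"])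
  have upper: "adjoint_pair
      (\<lambda>f k. if k \<in> UNIV \<times> range Inl then of_real (b (?idx (snd k))) * f (fst k - d, Inl (Suc (?idx (snd k)))) else 0)
      (\<lambda>f k. if k \<in> UNIV \<times> Inl ` range Suc
          then cnj (of_real (b (?idx (snd (fst k + d, Inl (?idx (snd k) - 1) :: nat + int)))))
            * f (fst k + d, Inl (?idx (snd k) - 1)) else 0)"
    by (rule adjoint_pair_weighted_injection[where C = 1])
       (auto simp: b intro!: bij_betw_byWitness[where f' = "\<lambda>k. (fst k + d, Inl (?idx (snd k) - 1))"])
  have lower: "adjoint_pair
      (\<lambda>f k. if k \<in> UNIV \<times> Inl ` range Suc then of_real (b (?idx (snd k) - 1)) * f (fst k - d, Inl (?idx (snd k) - 1)) else 0)
      (\<lambda>f k. if k \<in> UNIV \<times> range Inl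
          then cnj (of_real (b (?idx (snd (fst k + d, Inl (Suc (?idx (snd k))) :: nat + int)) - 1)))
            * f (fst k + d, Inl (Suc (?idx (snd k)))) else 0)"
    by (rule adjoint_pair_weighted_injection[where C = 1])
       (auto simp: b intro!: bij_betw_byWitness[where f' = "\<lambda>k. (fst k + d, Inl (Suc (?idx (snd k))))"])
  have eq: "(\<lambda>f. (\<lambda>k. if k \<in> UNIV then (case snd k of Inl j \<Rightarrow> of_real (a j) | Inr _ \<Rightarrow> 1) * f (fst k - d, snd k) else 0)
      + (\<lambda>k. if k \<in> UNIV \<times> range Inl then of_real (b (?idx (snd k))) * f (fst k - d, Inl (Suc (?idx (snd k)))) else 0)
      + (\<lambda>k. if k \<in> UNIV \<times> Inl ` range Suc then of_real (b (?idx (snd k) - 1)) * f (fst k - d, Inl (?idx (snd k) - 1)) else 0))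
    = jacobi_shift a b d"
  proof (intro ext, goal_cases)
    case (1 f k)
    show ?case
      by (cases k; cases "snd k"; cases "?idx (snd k)") (auto simp: jacobi_shift_def)
  qed
  have eq': "(\<lambda>f. (\<lambda>k. if k \<in> UNIV then cnj (case snd (fst k + d, snd k) of Inl j \<Rightarrow> of_real (a j) | Inr _ \<Rightarrow> 1)
          * f (fst k + d, snd k) else 0)
      + (\<lambda>k. if k \<in> UNIV \<times> Inl ` range Suc
          then cnj (of_real (b (?idx (snd (fst k + d, Inl (?idx (snd k) - 1) :: nat + int)))))
            * f (fst k + d, Inl (?idx (snd k) - 1)) else 0)
      + (\<lambda>k. if k \<in> UNIV \<times> range Inl
          then cnj (of_real (b (?idx (snd (fst k + d, Inl (Suc (?idx (snd k))) :: nat + int)) - 1)))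
            * f (fst k + d, Inl (Suc (?idx (snd k)))) else 0))
    = jacobi_shift a b (- d)"
  proof (intro ext, goal_cases)
    case (1 f k)
    show ?case
      by (cases k; cases "snd k"; cases "?idx (snd k)") (auto simp: jacobi_shift_def)
  qed
  show ?thesis
    using adjoint_pair_add[OF adjoint_pair_add[OF diag upper] lower] unfolding eq eq' .
qed

lemma adjoint_pair_fibre_shift: "adjoint_pair (fibre_shift d) (fibre_shift (- d))"
proof -
  have "adjoint_pair
      (\<lambda>(f :: int \<times> (nat + int) \<Rightarrow> complex) k. if k \<in> UNIV \<times> range Inr then 1 * f (fst k, map_sum id (\<lambda>n. n - d) (snd k)) else 0)
      (\<lambda>f k. if k \<in> UNIV \<times> range Inr then cnj 1 * f (fst k, map_sum id (\<lambda>n. n + d) (snd k)) else 0)"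
    by (rule adjoint_pair_weighted_injection[where C = 1])
       (auto intro!: bij_betw_byWitness[where f' = "\<lambda>k. (fst k, map_sum id (\<lambda>n. n + d) (snd k))"])
  moreover have "(\<lambda>f k. if k \<in> UNIV \<times> range Inr then 1 * f (fst k, map_sum id (\<lambda>n. n - d) (snd k)) else 0) = fibre_shift d"
    "(\<lambda>f k. if k \<in> UNIV \<times> range Inr then cnj 1 * f (fst k, map_sum id (\<lambda>n. n + d) (snd k)) else 0) = fibre_shift (- d)"
    by (intro ext; auto simp: fibre_shift_def split: sum.split sum.split_asm)+
  ultimately show ?thesis
    by (simp only:)
qed

lemma jacobi_shift_commute: "jacobi_shift a b d (jacobi_shift a b d' f) = jacobi_shift a b d' (jacobi_shift a b d f)"
  by (auto simp: jacobi_shift_def fun_eq_iff algebra_simps split: sum.split)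

lemma fibre_shift_commute: "fibre_shift d (fibre_shift d' f) = fibre_shift d' (fibre_shift d f)"
  by (auto simp: fibre_shift_def fun_eq_iff algebra_simps split: sum.split)

lemma jacobi_fibre_shift_commute: "jacobi_shift a b d (fibre_shift d' f) = fibre_shift d' (jacobi_shift a b d f)"
  by (auto simp: fibre_shift_def jacobi_shift_def fun_eq_iff split: sum.split)

text \<open>
  The basis vectors go to \<open>e\<^sub>m \<otimes> (c m \<oplus> y e\<^sub>0) / sqrt (\<gamma> m)\<close> for \<open>n = 0\<close> and to
  \<open>e\<^sub>m \<otimes> (0 \<oplus> e\<^sub>n)\<close> for \<open>n \<ge> 1\<close>: up to normalization the function
  \<open>sqrt s ^ m * sqrt t ^ n\<close>, twisted by its phase, in coordinates for the two parts of the measure.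
\<close>

definition moment_embedding ::
    "(nat \<Rightarrow> nat \<Rightarrow> real) \<Rightarrow> (nat \<Rightarrow> real) \<Rightarrow> real \<Rightarrow> (nat \<times> nat \<Rightarrow> complex) \<Rightarrow> int \<times> (nat + int) \<Rightarrow> complex" where
  "moment_embedding c \<gamma> y f = (\<lambda>(m, x). if m < 0 then 0 else case x of
      Inl j \<Rightarrow> of_real (c (nat m) j / sqrt (\<gamma> (nat m))) * f (nat m, 0)
    | Inr n \<Rightarrow> if n < 0 then 0
        else of_real (if n = 0 then y / sqrt (\<gamma> (nat m)) else 1) * f (nat m, nat n))"

text \<open>
  A bottom vector has squared norm \<open>(|c m|\<^sup>2 + y\<^sup>2) / \<gamma> m = 1\<close>. Accordingly the squares of the
  coordinates of \<open>f\<close> are split as \<open>F = G + (F - G)\<close>, with \<open>G\<close> the share of the Jacobi summand.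
\<close>

lemma isometric_embedding_moment_embedding:
  assumes \<gamma>: "\<And>m. 0 < \<gamma> m"
    and c0: "\<And>m j. m < j \<Longrightarrow> c m j = 0"
    and c: "\<And>m. (\<Sum>j\<le>m. (c m j)\<^sup>2) = \<gamma> m - y\<^sup>2"
  shows "isometric_embedding ell2 ell2 (moment_embedding c \<gamma> y)"
proof (rule isometric_embeddingI_norm)
  have sum: "((\<lambda>k. (cmod (moment_embedding c \<gamma> y f k))\<^sup>2) has_sum (\<Sum>\<^sub>\<infinity>k. (cmod (f k))\<^sup>2)) UNIV"
    if f: "f \<in> \<L>\<^sub>2" for f
  proof -
    let ?V = "moment_embedding c \<gamma> y f"
    have y_le: "y\<^sup>2 / \<gamma> m \<le> 1" for m
      using c[of m] \<gamma>[of m] sum_nonneg[of "{..m}" "\<lambda>j. (c m j)\<^sup>2"] by simp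
    define F :: "nat \<times> nat \<Rightarrow> real" where "F = (\<lambda>k. (cmod (f k))\<^sup>2)"
    define G :: "nat \<times> nat \<Rightarrow> real" where "G = (\<lambda>k. if snd k = 0 then (1 - y\<^sup>2 / \<gamma> (fst k)) * F k else 0)"
    have F: "(F has_sum infsum F UNIV) UNIV"
      using f by (simp add: F_def ell2_iff)
    have "G summable_on UNIV"
    proof (rule summable_on_comparison_test)
      show "F summable_on UNIV"
        using F by (rule has_sum_imp_summable)
      fix k :: "nat \<times> nat"
      have "0 \<le> y\<^sup>2 / \<gamma> (fst k)"
        using \<gamma>[of "fst k"] by simp
      then have "(1 - y\<^sup>2 / \<gamma> (fst k)) * F k \<le> 1 * F k"
        by (intro mult_right_mono) (auto simp: F_def)
      then show "G k \<le> F k"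
        by (auto simp: G_def F_def)
      show "0 \<le> G k"
        using y_le[of "fst k"] by (simp add: G_def F_def)
    qed
    then have G: "(G has_sum infsum G UNIV) UNIV"
      by simp
    have "((\<lambda>k. F k - G k) has_sum (infsum F UNIV - infsum G UNIV)) UNIV"
      using has_sum_add[OF F has_sum_uminusI[OF G]] by simp
    moreover have "F k - G k = (cmod (?V (int (fst k), Inr (int (snd k)))))\<^sup>2" for k :: "nat \<times> nat"
      using \<gamma>[of "fst k"]
      by (cases k) (auto simp: F_def G_def moment_embedding_def norm_mult power_mult_distrib power_divide norm_divide algebra_simps)
    ultimately have "((\<lambda>k. (cmod (?V k))\<^sup>2) has_sum (infsum F UNIV - infsum G UNIV))
        (range (\<lambda>k :: nat \<times> nat. (int (fst k), Inr (int (snd k)))))"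
      by (subst has_sum_reindex) (auto simp: inj_on_def o_def)
    also have "?this \<longleftrightarrow> ((\<lambda>k. (cmod (?V k))\<^sup>2) has_sum (infsum F UNIV - infsum G UNIV)) (UNIV \<times> range Inr)"
    proof (rule has_sum_cong_neutral)
      fix k :: "int \<times> (nat + int)"
      assume "k \<in> UNIV \<times> range Inr - range (\<lambda>k :: nat \<times> nat. (int (fst k), Inr (int (snd k))))"
      then obtain m n where k: "k = (m, Inr n)" and "\<nexists>p q. m = int p \<and> n = int q"
        by (auto simp: image_iff)
      then have "m < 0 \<or> n < 0"
        by (metis nat_0_le not_less)
      then show "(cmod (?V k))\<^sup>2 = 0"
        by (auto simp: k moment_embedding_def)
    qed auto
    finally have right: "((\<lambda>k. (cmod (?V k))\<^sup>2) has_sum (infsum F UNIV - infsum G UNIV)) (UNIV \<times> range Inr)" .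
    have "(G has_sum infsum G UNIV) (range (\<lambda>m. (m, 0)))"
      using G by (rule has_sum_cong_neutral[THEN iffD1, rotated -1]) (auto simp: G_def image_iff)
    then have bottom: "((\<lambda>m. G (m, 0)) has_sum infsum G UNIV) UNIV"
      by (subst (asm) has_sum_reindex) (auto simp: inj_on_def o_def)
    let ?L = "\<lambda>k. (cmod (?V (int (fst k), Inl (snd k))))\<^sup>2"
    have fibre: "((\<lambda>j. ?L (m, j)) has_sum G (m, 0)) {..m}" for m
    proof (rule has_sum_finiteI)
      have "(\<Sum>j\<le>m. ?L (m, j)) = (\<Sum>j\<le>m. (c m j)\<^sup>2 * (F (m, 0) / \<gamma> m))"
        using \<gamma>[of m] by (intro sum.cong)
          (auto simp: F_def moment_embedding_def norm_mult norm_divide power_mult_distrib power_divide)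
      also have "\<dots> = (\<gamma> m - y\<^sup>2) * (F (m, 0) / \<gamma> m)"
        by (simp only: c flip: sum_distrib_right)
      also have "\<dots> = G (m, 0)"
        using \<gamma>[of m] by (simp add: G_def field_simps)
      finally show "G (m, 0) = (\<Sum>j\<le>m. ?L (m, j))"
        by simp
    qed simp
    have "(?L has_sum infsum G UNIV) (Sigma UNIV (\<lambda>m. {..m}))"
    proof (rule has_sum_SigmaI[OF fibre bottom])
      show "?L summable_on Sigma UNIV (\<lambda>m. {..m})"
        using fibre has_sum_imp_summable[OF bottom] by (rule summable_on_SigmaI) auto
    qed
    then have "((\<lambda>k. (cmod (?V k))\<^sup>2) has_sum infsum G UNIV)
        ((\<lambda>k. (int (fst k), Inl (snd k))) ` Sigma UNIV (\<lambda>m. {..m}))"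
      by (subst has_sum_reindex) (auto simp: inj_on_def o_def)
    also have "?this \<longleftrightarrow> ((\<lambda>k. (cmod (?V k))\<^sup>2) has_sum infsum G UNIV) (UNIV \<times> range Inl)"
    proof (rule has_sum_cong_neutral)
      fix k :: "int \<times> (nat + int)"
      assume "k \<in> UNIV \<times> range Inl - (\<lambda>k. (int (fst k), Inl (snd k))) ` Sigma UNIV (\<lambda>m. {..m})"
      then obtain m j where k: "k = (m, Inl j)" and "\<nexists>p. m = int p \<and> j \<le> p"
        by (force simp: image_iff)
      then have "m < 0 \<or> nat m < j"
        by (metis nat_0_le not_less)
      then show "(cmod (?V k))\<^sup>2 = 0"
        by (auto simp: k moment_embedding_def c0)
    qed auto
    finally have left: "((\<lambda>k. (cmod (?V k))\<^sup>2) has_sum infsum G UNIV) (UNIV \<times> range Inl)" .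
    have "UNIV \<times> range Inl \<union> UNIV \<times> range Inr = (UNIV :: (int \<times> (nat + int)) set)"
      by (auto simp: image_iff) (metis sum.exhaust)
    then show ?thesis
      using has_sum_Un_disjoint[OF left right] by (auto simp: F_def)
  qed
  have maps: "moment_embedding c \<gamma> y f \<in> \<L>\<^sub>2" if "f \<in> \<L>\<^sub>2" for f
    using has_sum_imp_summable[OF sum[OF that]] by (simp add: ell2_iff)
  then show "linear_map ell2 ell2 (moment_embedding c \<gamma> y)"
    unfolding linear_map_def
    by (auto simp: moment_embedding_def fun_eq_iff algebra_simps add_divide_distrib split: sum.split)
  show "hinner ell2 (moment_embedding c \<gamma> y f) (moment_embedding c \<gamma> y f) = hinner ell2 f f"
    if "f \<in> \<L>\<^sub>2" for f
    using infsumI[OF sum[OF that]] by (simp add: hinner_self maps that)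
qed

text \<open>
  On the Jacobi summand the intertwining relation is \<open>J (c m) = c (m + 1)\<close>; the factor
  \<open>\<xi> m = sqrt (\<gamma> (m + 1) / \<gamma> m)\<close> adjusts the normalization. In the higher rows both sides
  are unweighted shifts.
\<close>

lemma jacobi_shift_moment_embedding:
  assumes \<gamma>: "\<And>m. 0 < \<gamma> m" "\<And>m. \<gamma> (Suc m) = (\<xi> m)\<^sup>2 * \<gamma> m" and \<xi>: "\<And>m. 0 < \<xi> m"
    and \<alpha>: "\<And>m. \<alpha> (m, 0) = \<xi> m" "\<And>m n. 1 \<le> n \<Longrightarrow> \<alpha> (m, n) = 1"
    and c: "\<And>m j. c (Suc m) j = a j * c m j + b j * c m (Suc j) + (if j = 0 then 0 else b (j - 1) * c m (j - 1))"
  shows "jacobi_shift a b 1 (moment_embedding c \<gamma> y f) = moment_embedding c \<gamma> y (shift1 \<alpha> f)"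
proof (rule ext)
  fix k :: "int \<times> (nat + int)"
  obtain m x where k: "k = (m, x)" by (cases k)
  have sqrt: "sqrt (\<gamma> (Suc p)) = \<xi> p * sqrt (\<gamma> p)" "sqrt (\<gamma> p) \<noteq> 0" "\<xi> p \<noteq> 0" for p
    using \<gamma>(1)[of p] \<xi>[of p] by (simp_all add: \<gamma>(2) real_sqrt_mult)
  show "jacobi_shift a b 1 (moment_embedding c \<gamma> y f) k = moment_embedding c \<gamma> y (shift1 \<alpha> f) k"
  proof (cases "m \<ge> 1")
    case False
    then have "m < 0 \<or> m = 0"
      by linarith
    then show ?thesis
      by (auto simp: k jacobi_shift_def moment_embedding_def shift1_def split: sum.split)
  next
    case True
    then obtain p where m: "m = int (Suc p)"
      by (metis Suc_pred' nat_0_le int_one_le_iff_zero_less order_less_imp_le zero_less_nat_eq)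
    show ?thesis
    proof (cases x)
      case (Inl j)
      have "jacobi_shift a b 1 (moment_embedding c \<gamma> y f) k = of_real (c (Suc p) j / sqrt (\<gamma> p)) * f (p, 0)"
        unfolding c by (simp add: k m Inl jacobi_shift_def moment_embedding_def) (simp add: field_simps sqrt add_divide_distrib)
      also have "\<dots> = moment_embedding c \<gamma> y (shift1 \<alpha> f) k"
        using sqrt[of p] by (simp add: k m Inl moment_embedding_def shift1_def \<alpha> nat_add_distrib)
      finally show ?thesis .
    next
      case (Inr n)
      consider "n < 0" | "n = 0" | "1 \<le> nat n" "0 < n"
        by linarith
      then show ?thesis
        using sqrt[of p]
        by cases (simp_all add: k m Inr jacobi_shift_def moment_embedding_def shift1_def \<alpha> nat_add_distrib)
    qed
  qed
qed

lemma fibre_shift_moment_embedding: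
  assumes \<beta>: "\<And>m. \<beta> (m, 0) = y / sqrt (\<gamma> m)" "\<And>m n. 1 \<le> n \<Longrightarrow> \<beta> (m, n) = 1"
  shows "fibre_shift 1 (moment_embedding c \<gamma> y f) = moment_embedding c \<gamma> y (shift2 \<beta> f)"
proof (rule ext)
  fix k :: "int \<times> (nat + int)"
  obtain m x where k: "k = (m, x)" by (cases k)
  show "fibre_shift 1 (moment_embedding c \<gamma> y f) k = moment_embedding c \<gamma> y (shift2 \<beta> f) k"
  proof (cases x)
    case (Inl j)
    then show ?thesis
      by (simp add: k fibre_shift_def moment_embedding_def shift2_def)
  next
    case (Inr n)
    show ?thesis
    proof (cases "n \<ge> 1")
      case True
      then obtain p where n: "n = int (Suc p)"
        by (metis Suc_pred' nat_0_le int_one_le_iff_zero_less order_less_imp_le zero_less_nat_eq)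
      show ?thesis
        by (cases p) (simp_all add: k n Inr fibre_shift_def moment_embedding_def shift2_def \<beta> nat_add_distrib)
    next
      case False
      then have "n < 0 \<or> n = 0"
        by linarith
      then show ?thesis
        by (auto simp: k Inr fibre_shift_def moment_embedding_def shift2_def)
    qed
  qed
qed

section \<open>Subnormality of the pair\<close>

theorem theorem5p2:
  fixes \<xi> :: "nat \<Rightarrow> real" and \<nu> :: "real measure" and \<gamma> :: "nat \<Rightarrow> real" and y :: real
    and \<alpha> \<beta> :: "nat \<times> nat \<Rightarrow> real"
  assumes "\<And>n. \<xi> n > 0" and "bounded (range \<xi>)"
    and "subnormal_op ell2 (wshift \<xi>)" and "opnorm ell2 (wshift \<xi>) \<le> 1"
    and "berger_measure \<xi> \<nu>"
    and "\<And>n. \<gamma> n = (\<integral>s. s ^ n \<partial>\<nu>)"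
    and "0 < y" and "y \<le> 1"
    and "\<And>k1. \<alpha> (k1, 0) = \<xi> k1"
    and "\<And>k1 k2. k2 \<ge> 1 \<Longrightarrow> \<alpha> (k1, k2) = 1"
    and "\<And>k1. \<beta> (k1, 0) = y / sqrt (\<gamma> k1)"
    and "\<And>k1 k2. k2 \<ge> 1 \<Longrightarrow> \<beta> (k1, k2) = 1"
    and "bounded (range \<alpha>)" and "bounded (range \<beta>)"
    and "hyponormal_pair ell2 (shift1 \<alpha>) (shift2 \<beta>)"
  shows "subnormal_pair ell2 (shift1 \<alpha>) (shift2 \<beta>)"
proof -
  note \<xi>_pos = assms(1) and \<gamma>_def = assms(6) and \<alpha> = assms(9,10) and \<beta> = assms(11,12)
    and bdd = assms(13,14) and hyp = assms(15)
  have prob: "prob_space \<nu>" and sets: "sets \<nu> = sets borel"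
    and AE: "AE s in \<nu>. s \<in> {0..(opnorm ell2 (wshift \<xi>))\<^sup>2}"
    and berger: "\<And>k. 1 \<le> k \<Longrightarrow> (\<Prod>i<k. (\<xi> i)\<^sup>2) = (\<integral>s. s ^ k \<partial>\<nu>)"
    using assms(5) unfolding berger_measure_def by auto
  have "0 \<le> opnorm ell2 (wshift \<xi>)"
    using assms(3) opnorm_nonneg unfolding subnormal_op_def by blast
  then have "(opnorm ell2 (wshift \<xi>))\<^sup>2 \<le> 1"
    using assms(4) by (simp add: power_le_one)
  then have supp: "AE s in \<nu>. s \<in> {0..1}"
    using AE by (auto elim!: AE_mp)
  have \<gamma>_prod: "\<gamma> n = (\<Prod>i<n. (\<xi> i)\<^sup>2)" for n
    using berger[of n] prob_space.prob_space[OF prob] by (cases n) (auto simp: \<gamma>_def)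
  have \<gamma>_pos: "0 < \<gamma> n" for n
    unfolding \<gamma>_prod using \<xi>_pos by (intro prod_pos zero_less_power) simp
  have \<gamma>_Suc: "\<gamma> (Suc n) = (\<xi> n)\<^sup>2 * \<gamma> n" for n
    by (simp add: \<gamma>_prod)
  have "y\<^sup>2 \<le> \<gamma> n" for n
  proof -
    have "(\<beta> (n, 0))\<^sup>2 \<le> (\<beta> (n, Suc 0))\<^sup>2"
      using hyponormal_shift2_weights_mono[OF bdd hyp] .
    then show ?thesis
      using \<gamma>_pos[of n] by (simp add: \<beta> power_divide)
  qed
  then have "y\<^sup>2 \<le> measure \<nu> {1}"
    unfolding \<gamma>_def by (rule measure_atom_at_1_ge[OF prob sets supp])
  then interpret moment_form
    "\<lambda>p q. (\<integral>s. poly p (sqrt s) * poly q (sqrt s) \<partial>\<nu>) - y\<^sup>2 * (poly p 1 * poly q 1)"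
    by (rule moment_form_minus_atom[OF prob sets supp])
  obtain a b :: "nat \<Rightarrow> real" and c :: "nat \<Rightarrow> nat \<Rightarrow> real"
    where a: "\<And>j. \<bar>a j\<bar> \<le> 1" and b: "\<And>j. \<bar>b j\<bar> \<le> 1"
    and rec: "\<And>m j. c (Suc m) j = a j * c m j + b j * c m (Suc j) + (if j = 0 then 0 else b (j - 1) * c m (j - 1))"
    and upper: "\<And>m j. m < j \<Longrightarrow> c m j = 0"
    and parseval: "\<And>m. (\<Sum>j\<le>m. (c m j)\<^sup>2)
      = (\<integral>s. poly (monom 1 m) (sqrt s) * poly (monom 1 m) (sqrt s) \<partial>\<nu>) - y\<^sup>2 * (poly (monom 1 m) 1 * poly (monom 1 m) 1)"
    using jacobi_matrix by blast
  have norm: "(\<Sum>j\<le>m. (c m j)\<^sup>2) = \<gamma> m - y\<^sup>2" for m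
    unfolding parseval monom_sqrt_integral[OF sets supp] by (simp add: \<gamma>_def poly_monom)
  have inf: "infinite (UNIV :: (int \<times> (nat + int)) set)"
    by (simp add: infinite_UNIV_int finite_prod)
  have "bij (\<lambda>k. from_nat_into (UNIV :: (int \<times> (nat + int)) set) (prod_encode k))"
    using bij_betw_trans[OF bij_prod_encode bij_betw_from_nat_into[OF _ inf]] by (simp add: o_def)
  then show ?thesis
  proof (rule subnormal_pair_ell2I[rotated 2])
    show "bounded_op ell2 (shift1 \<alpha>)" "bounded_op ell2 (shift2 \<beta>)"
      using hyp by (simp_all add: hyponormal_pair_def)
    show "isometric_embedding ell2 ell2 (moment_embedding c \<gamma> y)"
      using \<gamma>_pos upper norm by (rule isometric_embedding_moment_embedding)
    show "adjoint_pair (jacobi_shift a b 1) (jacobi_shift a b (- 1))"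
      using a b by (rule adjoint_pair_jacobi_shift)
    show "adjoint_pair (fibre_shift 1) (fibre_shift (- 1))"
      by (rule adjoint_pair_fibre_shift)
    show "jacobi_shift a b 1 (moment_embedding c \<gamma> y f) = moment_embedding c \<gamma> y (shift1 \<alpha> f)" for f
      using \<gamma>_pos \<gamma>_Suc \<xi>_pos \<alpha> rec by (rule jacobi_shift_moment_embedding)
    show "fibre_shift 1 (moment_embedding c \<gamma> y f) = moment_embedding c \<gamma> y (shift2 \<beta> f)" for f
      using \<beta> by (rule fibre_shift_moment_embedding)
  qed (rule jacobi_shift_commute fibre_shift_commute jacobi_fibre_shift_commute)+
qed

end
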